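(* Let $\theta_0>\theta_1>\theta_2$ and let $\Gamma$ be a graph in $\mathcal{G}(\theta_0,\theta_1,\theta_2)$ having precisely two distinct valencies, whose adjacency matrix $A$ under the valency partition has block form $$A=\begin{pmatrix} A_1 & B^{\top}\\ B & A_2\end{pmatrix}\quad\text{with quotient matrix}\quad\begin{pmatrix} k_{11} & k_{12}\\ k_{21} & k_{22}\end{pmatrix},$$ where $A_1$ and $J-I-A_2$ are cospectral. Assume $n=n_1=n_2$, where $n_i$ is the number of vertices with valency $k_i$. Then $k_{12}=k_{21}$ and $\Gamma$ has spectrum $\{[\theta_0]^1,[\theta]^n,[-\theta-1]^{n-1}\}$, where $\theta\in\{\theta_1,\theta_2\}$ is an eigenvalue of the quotient matrix of the valency partition of $\Gamma$ (the one other than $\theta_0$). Moreover, $BA_1=(J-I-A_2)B$, and $$B^{\top}B=(\theta I-A_1)(\theta I-(J-I-A_1)),\qquad BB^{\top}=(\theta I-A_2)(\theta I-(J-I-A_2)).$$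
   Context: All graphs are finite and simple. $\mathcal{G}(\theta_0,\theta_1,\theta_2)$ denotes the set of connected nonregular graphs whose adjacency matrix has precisely three distinct eigenvalues $\theta_0>\theta_1>\theta_2$. Valency means degree; the two distinct valencies are $k_1>k_2$, and the valency partition is $\{V_1,V_2\}$ with $V_i$ the set of vertices of valency $k_i$. The quotient matrix entry $k_{ij}$ is the average number of neighbours in $V_j$ of vertices of $V_i$. In a spectrum, $[\theta]^m$ means that $\theta$ is an eigenvalue with multiplicity $m$. $J$ is the all-ones matrix and $I$ the identity matrix (of order $n$). Cospectral means having the same eigenvalues with the same multiplicities. *)

theory Defs
  imports
    "Graph_Theory.Graph_Theory"
    "Jordan_Normal_Form.Spectral_Radius"
begin

text \<open>A finite simple graph is a \<open>pair_graph\<close>: finite, loop-free, without parallel arcs, and with a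
  symmetric arc relation. Each undirected edge is thus a pair of opposite arcs, and the valency of
  a vertex is its \<open>out_degree\<close>.\<close>

abbreviation valency :: "'a pair_pre_digraph \<Rightarrow> 'a \<Rightarrow> nat" where
  "valency G v \<equiv> out_degree (with_proj G) v"

definition valency_class :: "'a pair_pre_digraph \<Rightarrow> nat \<Rightarrow> 'a set" where
  "valency_class G k = {v \<in> pverts G. valency G v = k}"

definition regular :: "'a pair_pre_digraph \<Rightarrow> bool" where
  "regular G \<longleftrightarrow> (\<exists>k. \<forall>v \<in> pverts G. valency G v = k)"

definition vertex_ordering :: "'a set \<Rightarrow> 'a list \<Rightarrow> bool" where
  "vertex_ordering V vs \<longleftrightarrow> distinct vs \<and> set vs = V"

definition adjacency_matrix :: "'a pair_pre_digraph \<Rightarrow> 'a list \<Rightarrow> real mat" where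
  "adjacency_matrix G vs =
     mat (length vs) (length vs) (\<lambda>(i, j). if (vs ! i, vs ! j) \<in> parcs G then 1 else 0)"

text \<open>The set \<open>spectrum A\<close> of distinct eigenvalues of an adjacency matrix does not depend on the
  ordering of the vertices, so one ordering suffices in the following definition.\<close>

definition three_eigenvalue_graphs :: "real \<Rightarrow> real \<Rightarrow> real \<Rightarrow> 'a pair_pre_digraph set" where
  "three_eigenvalue_graphs \<theta>0 \<theta>1 \<theta>2 =
     {G. pair_graph G \<and> connected (with_proj G) \<and> \<not> regular G \<and>
         \<theta>0 > \<theta>1 \<and> \<theta>1 > \<theta>2 \<and>
         (\<exists>vs. vertex_ordering (pverts G) vs \<and>
               spectrum (adjacency_matrix G vs) = {\<theta>0, \<theta>1, \<theta>2})}"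

text \<open>Eigenvalues with (algebraic) multiplicity. This is applied to real symmetric matrices only,
  so that the real roots of the characteristic polynomial account for the whole spectrum and
  algebraic and geometric multiplicities agree.\<close>

definition eigenvalue_mset :: "real mat \<Rightarrow> real multiset" where
  "eigenvalue_mset A = proots (char_poly A)"

definition cospectral :: "real mat \<Rightarrow> real mat \<Rightarrow> bool" where
  "cospectral A B \<longleftrightarrow> eigenvalue_mset A = eigenvalue_mset B"

definition average_neighbours :: "'a pair_pre_digraph \<Rightarrow> 'a set \<Rightarrow> 'a set \<Rightarrow> real" where
  "average_neighbours G U W =
     (\<Sum>u \<in> U. real (card {w \<in> W. (u, w) \<in> parcs G})) / real (card U)"

definition all_ones_mat :: "nat \<Rightarrow> real mat" where
  "all_ones_mat n = mat n n (\<lambda>_. 1)"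

end

theory Submission
  imports Defs
begin

text \<open>Since the graph is connected with three eigenvalues,
  \<open>(A - \<theta>1 I) (A - \<theta>2 I) = \<alpha> \<alpha>\<^sup>T\<close> for a positive eigenvector \<open>\<alpha>\<close> of \<open>\<theta>0\<close>. The diagonal of this
  equation shows that \<open>\<alpha>\<close> takes only two values \<open>a\<close> and \<open>b\<close>, one on each valency class, and then
  \<open>A \<alpha> = \<theta>0 \<alpha>\<close> forces the valency partition to be equitable. Cospectrality enters only through the
  largest eigenvalues of \<open>A1\<close> and \<open>J - I - A2\<close>, which are their row sums: it gives
  \<open>k11 + k22 = n - 1\<close>. Comparing the row sums of the three blocks of the rank-one equation now yields
  \<open>\<theta>1 + \<theta>2 = -1\<close> and \<open>k12 = a b\<close>, which turns those blocks into the claimed matrix identities.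
  The vector with value \<open>b\<close> on \<open>V1\<close> and \<open>-a\<close> on \<open>V2\<close> is an eigenvector for
  \<open>\<theta> = k11 - a\<^sup>2\<close>, and the trace of \<open>A\<close> determines the multiplicities.\<close>

section \<open>Entrywise form of matrix products and of the eigenvalue equation\<close>

lemma mult_mat_vec_index:
  assumes "M \<in> carrier_mat m n" "v \<in> carrier_vec n" "i < m"
  shows "(M *\<^sub>v v) $ i = (\<Sum>j<n. M $$ (i, j) * v $ j)"
  using assms by (auto simp: scalar_prod_def row_def lessThan_atLeast0 intro!: sum.cong)

lemma mult_mat_index:
  assumes "M \<in> carrier_mat m n" "N \<in> carrier_mat n l" "i < m" "j < l"
  shows "(M * N) $$ (i, j) = (\<Sum>k<n. M $$ (i, k) * N $$ (k, j))"
  using assms by (auto simp: scalar_prod_def row_def lessThan_atLeast0 intro!: sum.cong)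

lemma symmetric_mat_index:
  assumes "transpose_mat M = M" "M \<in> carrier_mat n n" "i < n" "j < n"
  shows "M $$ (i, j) = M $$ (j, i)"
  using index_transpose_mat(1)[of i M j] assms by auto

text \<open>Treating eigenvectors as functions on indices lets all later arguments work with plain
  finite sums.\<close>

lemma real_eigenvalue_iff:
  fixes M :: "real mat"
  assumes "M \<in> carrier_mat n n"
  shows "eigenvalue M e \<longleftrightarrow>
    (\<exists>f. (\<exists>i<n. f i \<noteq> 0) \<and> (\<forall>i<n. (\<Sum>j<n. M $$ (i, j) * f j) = e * f i))"
proof
  assume "eigenvalue M e"
  then obtain v where v: "v \<in> carrier_vec n" "v \<noteq> 0\<^sub>v n" "M *\<^sub>v v = e \<cdot>\<^sub>v v"
    using assms by (auto simp: eigenvalue_def eigenvector_def)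
  have "\<exists>i<n. v $ i \<noteq> 0"
    using v(1,2) by (metis carrier_vecD eq_vecI index_zero_vec)
  moreover have "(\<Sum>j<n. M $$ (i, j) * v $ j) = e * v $ i" if "i < n" for i
    using mult_mat_vec_index[OF assms v(1) that] v(1,3) that by simp
  ultimately show "\<exists>f. (\<exists>i<n. f i \<noteq> 0) \<and> (\<forall>i<n. (\<Sum>j<n. M $$ (i, j) * f j) = e * f i)"
    by (intro exI[of _ "\<lambda>i. v $ i"]) blast
next
  assume "\<exists>f. (\<exists>i<n. f i \<noteq> 0) \<and> (\<forall>i<n. (\<Sum>j<n. M $$ (i, j) * f j) = e * f i)"
  then obtain f i where f: "i < n" "f i \<noteq> 0" "\<forall>i<n. (\<Sum>j<n. M $$ (i, j) * f j) = e * f i"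
    by blast
  have "M *\<^sub>v vec n f = e \<cdot>\<^sub>v vec n f"
  proof (rule eq_vecI)
    fix j assume "j < dim_vec (e \<cdot>\<^sub>v vec n f)"
    then have "j < n" by simp
    then show "(M *\<^sub>v vec n f) $ j = (e \<cdot>\<^sub>v vec n f) $ j"
      using f(3) by (subst mult_mat_vec_index[OF assms]) auto
  qed (use assms in auto)
  moreover have "vec n f \<noteq> 0\<^sub>v n"
    using f by (metis index_vec index_zero_vec(1))
  ultimately have "eigenvector M (vec n f) e"
    using assms by (simp add: eigenvector_def)
  then show "eigenvalue M e"
    by (auto simp: eigenvalue_def)
qed

section \<open>The spectral theorem for real symmetric matrices\<close>

text \<open>Over the complex numbers an eigenvector x + iy exists. Computing y^T M x in two ways by
  symmetry gives Im \<mu> (|x|^2 + |y|^2) = 0, so \<mu> is real and whichever of x and y is nonzero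
  is a real eigenvector.\<close>

lemma symmetric_real_eigenvalue_exists:
  fixes M :: "real mat"
  assumes M: "M \<in> carrier_mat n n" and sym: "transpose_mat M = M" and n: "n > 0"
  shows "\<exists>e. eigenvalue M e"
proof -
  let ?C = "map_mat complex_of_real M"
  have C: "?C \<in> carrier_mat n n" using M by simp
  obtain \<mu> where "eigenvalue ?C \<mu>"
    using spectrum_non_empty[OF C n] by (auto simp: spectrum_def)
  then obtain v where v: "v \<in> carrier_vec n" "v \<noteq> 0\<^sub>v n" "?C *\<^sub>v v = \<mu> \<cdot>\<^sub>v v"
    using C by (auto simp: eigenvalue_def eigenvector_def)
  have eq: "(\<Sum>j<n. complex_of_real (M $$ (i, j)) * v $ j) = \<mu> * v $ i" if "i < n" for i
    using mult_mat_vec_index[OF C v(1) that] v M that by simp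
  define x y where "x = (\<lambda>i. Re (v $ i))" and "y = (\<lambda>i. Im (v $ i))"
  have Mx: "(\<Sum>j<n. M $$ (i, j) * x j) = Re \<mu> * x i - Im \<mu> * y i" if "i < n" for i
    using arg_cong[OF eq[OF that], of Re] by (simp add: x_def y_def)
  have My: "(\<Sum>j<n. M $$ (i, j) * y j) = Im \<mu> * x i + Re \<mu> * y i" if "i < n" for i
    using arg_cong[OF eq[OF that], of Im] by (simp add: x_def y_def add.commute)
  have nz: "\<exists>i<n. x i \<noteq> 0 \<or> y i \<noteq> 0"
    using v(1,2) unfolding x_def y_def
    by (metis carrier_vecD complex_eqI eq_vecI index_zero_vec zero_complex.sel)
  have "(\<Sum>i<n. y i * (Re \<mu> * x i - Im \<mu> * y i)) = (\<Sum>i<n. \<Sum>j<n. y i * (M $$ (i, j) * x j))"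
    by (intro sum.cong refl) (simp add: Mx[symmetric] sum_distrib_left)
  also have "\<dots> = (\<Sum>j<n. \<Sum>i<n. y i * (M $$ (i, j) * x j))"
    by (rule sum.swap)
  also have "\<dots> = (\<Sum>j<n. x j * (Im \<mu> * x j + Re \<mu> * y j))"
    by (intro sum.cong refl)
      (auto simp: My[symmetric] sum_distrib_left intro!: sum.cong symmetric_mat_index[OF sym M])
  finally have "Im \<mu> * (\<Sum>i<n. (x i)\<^sup>2 + (y i)\<^sup>2) = 0"
    by (simp add: algebra_simps sum.distrib sum_subtractf sum_distrib_left power2_eq_square)
  moreover have "(\<Sum>i<n. (x i)\<^sup>2 + (y i)\<^sup>2) \<noteq> 0"
    using nz by (subst sum_nonneg_eq_0_iff) (auto simp: add_nonneg_eq_0_iff)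
  ultimately have "Im \<mu> = 0" by simp
  then show ?thesis
    using nz Mx My by (auto simp: real_eigenvalue_iff[OF M])
qed

text \<open>The reflection I - (2/c) w w^T with w = v - e0 and c = |w|^2 interchanges the unit
  vectors v and e0. It completes v to an orthogonal matrix that is its own inverse.\<close>

lemma householder_reflection:
  fixes v :: "real vec"
  assumes v: "v \<in> carrier_vec n" and n: "n > 0" and unit: "v \<bullet> v = 1"
  shows "\<exists>H \<in> carrier_mat n n. transpose_mat H = H \<and> H * H = 1\<^sub>m n \<and> col H 0 = v"
proof (cases "v = unit_vec n 0")
  case True
  with n show ?thesis by (intro bexI[of _ "1\<^sub>m n"]) auto
next
  case False
  define w where "w = v - unit_vec n 0"
  have w: "w \<in> carrier_vec n" using v by (simp add: w_def)
  define c where "c = w \<bullet> w"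
  have c: "c = 2 - 2 * v $ 0"
    using n v unit unfolding c_def w_def
    by (simp add: minus_scalar_prod_distrib[of _ n] scalar_prod_minus_distrib[of _ n])
  have csum: "c = (\<Sum>k<n. w $ k * w $ k)"
    using w by (auto simp: c_def scalar_prod_def lessThan_atLeast0)
  have "\<exists>i<n. w $ i \<noteq> 0"
  proof (rule ccontr)
    assume "\<not> (\<exists>i<n. w $ i \<noteq> 0)"
    then have "v $ i = unit_vec n 0 $ i" if "i < n" for i
      using that v by (force simp: w_def)
    with False v show False by (metis carrier_vecD eq_vecI index_unit_vec(3))
  qed
  then have c0: "c \<noteq> 0"
    unfolding csum by (subst sum_nonneg_eq_0_iff) auto
  define H where "H = mat n n (\<lambda>(i, j). (if i = j then 1 else 0) - 2 / c * w $ i * w $ j)"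
  have H: "H \<in> carrier_mat n n" by (simp add: H_def)
  have "transpose_mat H = H" by (auto simp: H_def)
  moreover have "H * H = 1\<^sub>m n"
  proof (rule eq_matI)
    fix i j assume "i < dim_row (1\<^sub>m n :: real mat)" "j < dim_col (1\<^sub>m n :: real mat)"
    then have ij: "i < n" "j < n" by auto
    have "(H * H) $$ (i, j) = (\<Sum>k<n. H $$ (i, k) * H $$ (k, j))"
      by (rule mult_mat_index[OF H H ij])
    \<comment> \<open>The summands are supported at \<open>k = i\<close>, supported at
      \<open>k = j\<close>, or multiples of the square of \<open>w $ k\<close>, and these squares
      sum to \<open>c\<close>.\<close>
    also have "\<dots> = (\<Sum>k<n. (if k = i then (if i = j then 1 else 0) - 2 / c * w $ i * w $ j else 0)
       - (if k = j then 2 / c * w $ i * w $ j else 0)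
       + 2 / c * w $ i * (2 / c * w $ j) * (w $ k * w $ k))"
      using ij by (intro sum.cong) (auto simp: H_def algebra_simps)
    also have "\<dots> = (if i = j then 1 else 0) - 4 / c * w $ i * w $ j
       + 2 / c * w $ i * (2 / c * w $ j) * c"
      using ij unfolding sum.distrib sum_subtractf sum_distrib_left[symmetric] csum[symmetric]
      by simp
    also have "\<dots> = (if i = j then 1 else 0)"
      using c0 by simp
    finally show "(H * H) $$ (i, j) = (1\<^sub>m n) $$ (i, j)" using ij by simp
  qed (use H in auto)
  moreover have "col H 0 = v"
  proof (rule eq_vecI)
    fix i assume "i < dim_vec v"
    then have i: "i < n" using v by simp
    \<comment> \<open>This makes the coefficient of w in column 0 equal to +1, so that column is e0
      + w = v.\<close>
    have "w $ 0 = - c / 2" using c n v by (simp add: w_def)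
    then have "col H 0 $ i = (if i = 0 then 1 else 0) + w $ i"
      using i n c0 H by (simp add: H_def)
    also have "\<dots> = v $ i" using i n v by (simp add: w_def)
    finally show "col H 0 $ i = v $ i" .
  qed (use v H in auto)
  ultimately show ?thesis using H by blast
qed

text \<open>Deflation by induction on the size: a reflection H whose first column is a unit
  eigenvector makes the first column of H M H a multiple of e0. By symmetry the first row vanishes
  off the diagonal as well, so H M H splits into a scalar and a smaller symmetric block.\<close>

theorem symmetric_real_diagonalization:
  fixes M :: "real mat"
  assumes "M \<in> carrier_mat n n" and "transpose_mat M = M"
  shows "\<exists>P d. P \<in> carrier_mat n n \<and> transpose_mat P * P = 1\<^sub>m n \<and>
    transpose_mat P * M * P = mat_diag n d"
  using assms
proof (induction n arbitrary: M)
  case 0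
  then show ?case by (intro exI[of _ "1\<^sub>m 0"] exI[of _ "\<lambda>_. 0"]) (auto simp: mat_diag_def intro!: eq_matI)
next
  case (Suc m)
  note M = Suc.prems(1) and sym = Suc.prems(2)
  let ?n = "Suc m"
  obtain e where "eigenvalue M e"
    using symmetric_real_eigenvalue_exists[OF M sym] by auto
  then obtain u where u: "u \<in> carrier_vec ?n" "u \<noteq> 0\<^sub>v ?n" "M *\<^sub>v u = e \<cdot>\<^sub>v u"
    using M by (auto simp: eigenvalue_def eigenvector_def)
  define v where "v = (1 / sqrt (u \<bullet> u)) \<cdot>\<^sub>v u"
  have uu: "u \<bullet> u > 0"
    using u conjugate_square_greater_0_vec[of u ?n] by simp
  have v: "v \<in> carrier_vec ?n" and vv: "v \<bullet> v = 1" and Mv: "M *\<^sub>v v = e \<cdot>\<^sub>v v"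
    using u uu by (auto simp: v_def mult_mat_vec[OF M] smult_smult_assoc mult.commute)
  obtain H where H: "H \<in> carrier_mat ?n ?n" and Hsym: "transpose_mat H = H"
    and HH: "H * H = 1\<^sub>m ?n" and H0: "col H 0 = v"
    using householder_reflection[OF v _ vv] by auto
  define N where "N = H * M * H"
  have N: "N \<in> carrier_mat ?n ?n" using H M by (simp add: N_def)
  have Nsym: "transpose_mat N = N"
    unfolding N_def using H M Hsym sym
    by (simp add: transpose_mult[of _ ?n ?n _ ?n] assoc_mult_mat[of _ ?n ?n _ ?n _ ?n])
  have "col N 0 = (H * M) *\<^sub>v v"
    unfolding N_def by (subst col_mult2[of _ ?n ?n _ ?n]) (use H M H0 in auto)
  also have "\<dots> = H *\<^sub>v (M *\<^sub>v v)"
    by (rule assoc_mult_mat_vec[OF H M v])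
  also have "\<dots> = e \<cdot>\<^sub>v (H *\<^sub>v col H 0)"
    unfolding Mv H0 by (rule mult_mat_vec[OF H v])
  also have "H *\<^sub>v col H 0 = col (H * H) 0"
    by (rule col_mult2[OF H H, symmetric]) simp
  finally have N0: "col N 0 = e \<cdot>\<^sub>v unit_vec ?n 0" by (simp add: HH)
  define N' where "N' = mat m m (\<lambda>(i, j). N $$ (Suc i, Suc j))"
  have N': "N' \<in> carrier_mat m m" by (simp add: N'_def)
  have N'sym: "transpose_mat N' = N'"
    using symmetric_mat_index[OF Nsym N] by (auto simp: N'_def)
  let ?E = "mat 1 1 (\<lambda>_. e)"
  have Nblock: "N = four_block_mat ?E (0\<^sub>m 1 m) (0\<^sub>m m 1) N'"
  proof (rule eq_matI)
    fix i j
    assume "i < dim_row (four_block_mat ?E (0\<^sub>m 1 m) (0\<^sub>m m 1) N')"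
      and "j < dim_col (four_block_mat ?E (0\<^sub>m 1 m) (0\<^sub>m m 1) N')"
    then have ij: "i < ?n" "j < ?n" by (auto simp: N'_def)
    have col0: "N $$ (k, 0) = (if k = 0 then e else 0)" if "k < ?n" for k
      using arg_cong[OF N0, of "\<lambda>x. x $ k"] that N by simp
    show "N $$ (i, j) = four_block_mat ?E (0\<^sub>m 1 m) (0\<^sub>m m 1) N' $$ (i, j)"
      using ij N col0 symmetric_mat_index[OF Nsym N, of 0 j]
      by (cases i; cases j) (auto simp: N'_def)
  qed (use N in \<open>auto simp: N'_def\<close>)
  obtain P' d where P': "P' \<in> carrier_mat m m" and P'orth: "transpose_mat P' * P' = 1\<^sub>m m"
    and P'diag: "transpose_mat P' * N' * P' = mat_diag m d"
    using Suc.IH[OF N' N'sym] by blast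
  define K where "K = four_block_mat (1\<^sub>m 1) (0\<^sub>m 1 m) (0\<^sub>m m 1) P'"
  have K: "K \<in> carrier_mat ?n ?n" using P' by (intro carrier_matI) (simp_all add: K_def)
  have KT: "transpose_mat K = four_block_mat (1\<^sub>m 1) (0\<^sub>m 1 m) (0\<^sub>m m 1) (transpose_mat P')"
    unfolding K_def using P' by (subst transpose_four_block_mat) auto
  have KK: "transpose_mat K * K = 1\<^sub>m ?n"
    unfolding KT unfolding K_def
    using P' P'orth by (subst mult_four_block_mat[of _ 1 1 _ m _ m _ _ 1 _ m]) (auto simp: four_block_one_mat)
  have "transpose_mat K * N = four_block_mat ?E (0\<^sub>m 1 m) (0\<^sub>m m 1) (transpose_mat P' * N')"
    unfolding KT Nblock
    using P' N' by (subst mult_four_block_mat[of _ 1 1 _ m _ m _ _ 1 _ m]) auto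
  then have KNK: "transpose_mat K * N * K = four_block_mat ?E (0\<^sub>m 1 m) (0\<^sub>m m 1) (mat_diag m d)"
    unfolding K_def
    using P' N' P'diag by (auto simp: mult_four_block_mat[of _ 1 1 _ m _ m _ _ 1 _ m])
  have "transpose_mat K * N * K = mat_diag ?n (\<lambda>i. if i = 0 then e else d (i - 1))"
    unfolding KNK mat_diag_def by (rule eq_matI) auto
  moreover have "transpose_mat (H * K) * M * (H * K) = transpose_mat K * N * K"
    unfolding N_def using H K M Hsym
    by (simp add: transpose_mult[of _ ?n ?n _ ?n] assoc_mult_mat[of _ ?n ?n _ ?n _ ?n])
  moreover have "transpose_mat (H * K) * (H * K) = transpose_mat K * (H * H) * K"
    using H K Hsym
    by (simp add: transpose_mult[of _ ?n ?n _ ?n] assoc_mult_mat[of _ ?n ?n _ ?n _ ?n])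
  ultimately show ?case
    using KK HH H K
    by (intro exI[of _ "H * K"] exI[of _ "\<lambda>i. if i = 0 then e else d (i - 1)"]) auto
qed

text \<open>Here \<open>u k\<close> is column k of the orthogonal matrix P. The two orthogonality
  relations are P^T P = I and P P^T = I, the expansion is M = P D P^T, and the characteristic
  polynomial comes from similarity to D.\<close>

lemma symmetric_real_spectral_expansion:
  fixes M :: "real mat"
  assumes M: "M \<in> carrier_mat n n" and sym: "transpose_mat M = M"
  obtains u d where
    "\<And>k l. k < n \<Longrightarrow> l < n \<Longrightarrow> (\<Sum>i<n. u k i * u l i) = (if k = l then 1 else 0)"
    "\<And>i j. i < n \<Longrightarrow> j < n \<Longrightarrow> (\<Sum>k<n. u k i * u k j) = (if i = j then 1 else 0)"
    "\<And>i j. i < n \<Longrightarrow> j < n \<Longrightarrow> M $$ (i, j) = (\<Sum>k<n. d k * u k i * u k j)"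
    "char_poly M = (\<Prod>k<n. [:- d k, 1:])"
proof -
  obtain P d where P: "P \<in> carrier_mat n n" and PP: "transpose_mat P * P = 1\<^sub>m n"
    and D: "transpose_mat P * M * P = mat_diag n d"
    using symmetric_real_diagonalization[OF M sym] by blast
  have PT: "transpose_mat P \<in> carrier_mat n n" using P by simp
  have PP': "P * transpose_mat P = 1\<^sub>m n"
    by (rule mat_mult_left_right_inverse[OF PT P PP])
  have "P * mat_diag n d * transpose_mat P = (P * transpose_mat P) * M * (P * transpose_mat P)"
    unfolding D[symmetric] using P M by (simp add: assoc_mult_mat[of _ n n _ n _ n])
  then have MP: "M = P * mat_diag n d * transpose_mat P"
    using M by (simp add: PP')
  have DM: "mat_diag n d \<in> carrier_mat n n" by simp
  define u where "u = (\<lambda>k i. P $$ (i, k))"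
  have 1: "(\<Sum>i<n. u k i * u l i) = (if k = l then 1 else 0)" if "k < n" "l < n" for k l
  proof -
    have "(transpose_mat P * P) $$ (k, l) = (\<Sum>i<n. u k i * u l i)"
      using that P by (subst mult_mat_index[OF PT P that]) (auto simp: u_def)
    then show ?thesis using that by (simp add: PP)
  qed
  have 2: "(\<Sum>k<n. u k i * u k j) = (if i = j then 1 else 0)" if "i < n" "j < n" for i j
  proof -
    have "(P * transpose_mat P) $$ (i, j) = (\<Sum>k<n. u k i * u k j)"
      using that P by (subst mult_mat_index[OF P PT that]) (auto simp: u_def)
    then show ?thesis using that by (simp add: PP')
  qed
  have 3: "M $$ (i, j) = (\<Sum>k<n. d k * u k i * u k j)" if "i < n" "j < n" for i j
    unfolding MP mat_diag_mult_right[OF P]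
    using that P
    by (subst mult_mat_index[of _ n n _ n]) (auto simp: u_def algebra_simps intro!: sum.cong)
  have "similar_mat_wit M (mat_diag n d) P (transpose_mat P)"
    using M P PP PP' MP by (auto simp: similar_mat_wit_def Let_def)
  then have "char_poly M = char_poly (mat_diag n d)"
    by (intro char_poly_similar) (auto simp: similar_mat_def)
  also have "\<dots> = (\<Prod>a\<leftarrow>diag_mat (mat_diag n d). [:- a, 1:])"
    by (rule char_poly_upper_triangular[OF DM]) (auto simp: mat_diag_def)
  also have "diag_mat (mat_diag n d) = map d [0..<n]"
    by (auto simp: diag_mat_def mat_diag_def)
  also have "(\<Prod>a\<leftarrow>map d [0..<n]. [:- a, 1:]) = (\<Prod>k<n. [:- d k, 1:])"
    by (simp add: prod.distinct_set_conv_list[symmetric] o_def lessThan_atLeast0)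
  finally have 4: "char_poly M = (\<Prod>k<n. [:- d k, 1:])" .
  show ?thesis by (rule that[OF 1 2 3 4])
qed

text \<open>In eigenbasis coordinates z the assumed inequality reads: the sum of (t - d_k) z_k^2 is
  at most 0. All its terms are nonnegative, so z_k = 0 unless d_k = t, and y satisfies the
  eigenvalue equation for t.\<close>

lemma rayleigh_equality:
  fixes M :: "real mat"
  assumes M: "M \<in> carrier_mat n n" and sym: "transpose_mat M = M"
    and top: "\<And>e. eigenvalue M e \<Longrightarrow> e \<le> t"
    and ge: "t * (\<Sum>i<n. (y i)\<^sup>2) \<le> (\<Sum>i<n. \<Sum>j<n. y i * M $$ (i, j) * y j)"
    and i: "i < n"
  shows "(\<Sum>j<n. M $$ (i, j) * y j) = t * y i"
proof -
  obtain u d where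
    "\<And>k l. k < n \<Longrightarrow> l < n \<Longrightarrow> (\<Sum>i<n. u k i * u l i) = (if k = l then 1 else 0)"
    and orth: "\<And>i j. i < n \<Longrightarrow> j < n \<Longrightarrow> (\<Sum>k<n. u k i * u k j) = (if i = j then 1 else 0)"
    and Mud: "\<And>i j. i < n \<Longrightarrow> j < n \<Longrightarrow> M $$ (i, j) = (\<Sum>k<n. d k * u k i * u k j)"
    and cp: "char_poly M = (\<Prod>k<n. [:- d k, 1:])"
    by (rule symmetric_real_spectral_expansion[OF M sym]) (rule that)
  have d: "d k \<le> t" if "k < n" for k
    using that by (intro top) (auto simp: eigenvalue_root_char_poly[OF M] cp poly_prod)
  define z where "z = (\<lambda>k. \<Sum>i<n. u k i * y i)"
  have My: "(\<Sum>j<n. M $$ (i, j) * y j) = (\<Sum>k<n. d k * u k i * z k)" if "i < n" for i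
  proof -
    have "(\<Sum>j<n. M $$ (i, j) * y j) = (\<Sum>j<n. \<Sum>k<n. d k * u k i * u k j * y j)"
      using that by (simp add: Mud sum_distrib_right)
    also have "\<dots> = (\<Sum>k<n. \<Sum>j<n. d k * u k i * u k j * y j)"
      by (rule sum.swap)
    finally show ?thesis by (simp add: z_def sum_distrib_left mult.assoc)
  qed
  have y: "(\<Sum>k<n. u k i * z k) = y i" if "i < n" for i
  proof -
    have "(\<Sum>k<n. u k i * z k) = (\<Sum>k<n. \<Sum>j<n. u k i * u k j * y j)"
      by (simp add: z_def sum_distrib_left mult.assoc)
    also have "\<dots> = (\<Sum>j<n. (\<Sum>k<n. u k i * u k j) * y j)"
      by (subst sum.swap) (simp add: sum_distrib_right)
    also have "\<dots> = (\<Sum>j<n. if i = j then y j else 0)"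
      using that by (intro sum.cong) (auto simp: orth)
    also have "\<dots> = y i" using that by simp
    finally show ?thesis .
  qed
  \<comment> \<open>The choice \<open>c = d\<close> gives the quadratic form of M, and the constant
    1 gives the squared norm.\<close>
  have quad: "(\<Sum>i<n. y i * (\<Sum>k<n. c k * u k i * z k)) = (\<Sum>k<n. c k * (z k)\<^sup>2)" for c
  proof -
    have "(\<Sum>i<n. y i * (\<Sum>k<n. c k * u k i * z k)) = (\<Sum>i<n. \<Sum>k<n. c k * z k * (u k i * y i))"
      by (simp add: sum_distrib_left algebra_simps)
    also have "\<dots> = (\<Sum>k<n. \<Sum>i<n. c k * z k * (u k i * y i))"
      by (rule sum.swap)
    also have "\<dots> = (\<Sum>k<n. c k * z k * z k)"
      unfolding z_def sum_distrib_left[symmetric] ..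
    finally show ?thesis by (simp add: power2_eq_square mult.assoc)
  qed
  have "(\<Sum>i<n. \<Sum>j<n. y i * M $$ (i, j) * y j) = (\<Sum>k<n. d k * (z k)\<^sup>2)"
    unfolding quad[symmetric]
    by (intro sum.cong refl, subst My[symmetric]) (auto simp: sum_distrib_left mult.assoc)
  moreover have "(\<Sum>i<n. (y i)\<^sup>2) = (\<Sum>k<n. (z k)\<^sup>2)"
    using quad[of "\<lambda>_. 1"] by (simp add: y power2_eq_square)
  ultimately have "(\<Sum>k<n. (t - d k) * (z k)\<^sup>2) \<le> 0"
    using ge by (simp add: left_diff_distrib sum_subtractf sum_distrib_left)
  then have "(\<Sum>k<n. (t - d k) * (z k)\<^sup>2) = 0"
    using d by (intro antisym sum_nonneg) auto
  then have "\<forall>k<n. (t - d k) * (z k)\<^sup>2 = 0"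
    using d by (subst (asm) sum_nonneg_eq_0_iff) auto
  then have "(\<Sum>k<n. d k * u k i * z k) = (\<Sum>k<n. t * (u k i * z k))"
    by (intro sum.cong) auto
  then show ?thesis
    using i by (simp add: My y sum_distrib_left[symmetric])
qed

section \<open>Perron vectors of irreducible symmetric matrices\<close>

text \<open>Phrasing irreducibility by closed index sets fits both uses: the zero set of an
  eigenvector is shown to be closed, and in a connected graph a nonempty closed vertex set is
  everything.\<close>

definition irreducible_mat :: "nat \<Rightarrow> real mat \<Rightarrow> bool" where
  "irreducible_mat n M \<longleftrightarrow>
     (\<forall>S \<subseteq> {..<n}. S \<noteq> {} \<longrightarrow> (\<forall>i\<in>S. \<forall>j<n. M $$ (i, j) \<noteq> 0 \<longrightarrow> j \<in> S) \<longrightarrow> S = {..<n})"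

locale irreducible_symmetric =
  fixes n :: nat and M :: "real mat" and t :: real
  assumes M: "M \<in> carrier_mat n n" and sym: "transpose_mat M = M"
    and nonneg: "\<And>i j. i < n \<Longrightarrow> j < n \<Longrightarrow> M $$ (i, j) \<ge> 0"
    and irreducible: "irreducible_mat n M"
    and top: "\<And>e. eigenvalue M e \<Longrightarrow> e \<le> t"
begin

text \<open>Passing to absolute values keeps the norm and, as the entries of M are nonnegative, does
  not decrease the quadratic form. So |x| also attains the Rayleigh bound.\<close>

lemma abs_eigenvector:
  assumes x: "\<And>i. i < n \<Longrightarrow> (\<Sum>j<n. M $$ (i, j) * x j) = t * x i" and i: "i < n"
  shows "(\<Sum>j<n. M $$ (i, j) * \<bar>x j\<bar>) = t * \<bar>x i\<bar>"
proof (rule rayleigh_equality[OF M sym top _ i])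
  have "t * (\<Sum>i<n. \<bar>x i\<bar>\<^sup>2) = (\<Sum>i<n. x i * (t * x i))"
    by (simp add: sum_distrib_left power2_eq_square algebra_simps)
  also have "\<dots> = (\<Sum>i<n. \<Sum>j<n. x i * M $$ (i, j) * x j)"
    by (simp add: x[symmetric] sum_distrib_left mult.assoc)
  also have "\<dots> \<le> (\<Sum>i<n. \<Sum>j<n. \<bar>x i\<bar> * M $$ (i, j) * \<bar>x j\<bar>)"
  proof (intro sum_mono)
    fix i j assume "i \<in> {..<n}" "j \<in> {..<n}"
    then have "\<bar>x i * M $$ (i, j) * x j\<bar> = \<bar>x i\<bar> * M $$ (i, j) * \<bar>x j\<bar>"
      using nonneg by (simp add: abs_mult)
    then show "x i * M $$ (i, j) * x j \<le> \<bar>x i\<bar> * M $$ (i, j) * \<bar>x j\<bar>"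
      by linarith
  qed
  finally show "t * (\<Sum>i<n. \<bar>x i\<bar>\<^sup>2) \<le> (\<Sum>i<n. \<Sum>j<n. \<bar>x i\<bar> * M $$ (i, j) * \<bar>x j\<bar>)" .
qed

text \<open>At a zero of |x| the eigenvalue equation is a vanishing sum of nonnegative terms, so x
  vanishes at every index joined to it. The zero set is therefore closed, and irreducibility makes
  it everything once it is nonempty.\<close>

lemma eigenvector_nowhere_zero:
  assumes x: "\<And>i. i < n \<Longrightarrow> (\<Sum>j<n. M $$ (i, j) * x j) = t * x i"
    and i: "i < n" "x i = 0" and j: "j < n"
  shows "x j = 0"
proof -
  let ?S = "{k. k < n \<and> x k = 0}"
  have closed: "l \<in> ?S" if "k \<in> ?S" "l < n" "M $$ (k, l) \<noteq> 0" for k l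
  proof -
    have "(\<Sum>j<n. M $$ (k, j) * \<bar>x j\<bar>) = 0"
      using that abs_eigenvector[OF x] by simp
    then have "M $$ (k, l) * \<bar>x l\<bar> = 0"
      using that nonneg by (subst (asm) sum_nonneg_eq_0_iff) auto
    with that show ?thesis by simp
  qed
  have "?S = {..<n}"
  proof (rule irreducible[unfolded irreducible_mat_def, rule_format])
    show "?S \<subseteq> {..<n}" by blast
    show "?S \<noteq> {}" using i by blast
  qed (rule closed)
  with j show ?thesis by blast
qed

text \<open>The combination of x and y that vanishes at \<open>j\<close> satisfies the same
  eigenvalue equation, hence vanishes everywhere.\<close>

lemma eigenvector_unique:
  assumes x: "\<And>i. i < n \<Longrightarrow> (\<Sum>j<n. M $$ (i, j) * x j) = t * x i"
    and y: "\<And>i. i < n \<Longrightarrow> (\<Sum>j<n. M $$ (i, j) * y j) = t * y i"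
    and ij: "i < n" "j < n"
  shows "x i * y j = y i * x j"
proof -
  define z where "z = (\<lambda>i. x i * y j - y i * x j)"
  have "(\<Sum>k<n. M $$ (l, k) * z k) = t * z l" if "l < n" for l
  proof -
    have "(\<Sum>k<n. M $$ (l, k) * z k)
        = (\<Sum>k<n. M $$ (l, k) * x k) * y j - (\<Sum>k<n. M $$ (l, k) * y k) * x j"
      by (simp add: z_def right_diff_distrib sum_subtractf sum_distrib_right mult.assoc)
    also have "\<dots> = t * z l"
      unfolding x[OF that] y[OF that] by (simp add: z_def right_diff_distrib mult.assoc)
    finally show ?thesis .
  qed
  from eigenvector_nowhere_zero[OF this ij(2) _ ij(1)] show ?thesis
    by (simp add: z_def)
qed

end

lemma sum_singleton_mset_const:
  "finite K \<Longrightarrow> (\<And>k. k \<in> K \<Longrightarrow> f k = c) \<Longrightarrow> (\<Sum>k\<in>K. {#f k#}) = replicate_mset (card K) c"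
  by (induction K rule: finite_induct) auto

text \<open>With exactly three eigenvalues, \<open>(M - t1 I) (M - t2 I)\<close> vanishes off the simple top eigenspace,
  so it is the rank-one matrix of a suitably scaled Perron vector.\<close>

theorem three_eigenvalues_perron:
  fixes M :: "real mat"
  assumes M: "M \<in> carrier_mat n n" and sym: "transpose_mat M = M"
    and nonneg: "\<And>i j. i < n \<Longrightarrow> j < n \<Longrightarrow> M $$ (i, j) \<ge> 0"
    and irreducible: "irreducible_mat n M"
    and spec: "spectrum M = {t0, t1, t2}" and t: "t0 > t1" "t1 > t2"
  obtains \<alpha> m l where
    "\<And>i. i < n \<Longrightarrow> \<alpha> i > 0"
    "\<And>i. i < n \<Longrightarrow> (\<Sum>j<n. M $$ (i, j) * \<alpha> j) = t0 * \<alpha> i"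
    "\<And>i j. i < n \<Longrightarrow> j < n \<Longrightarrow>
      (\<Sum>k<n. M $$ (i, k) * M $$ (k, j)) - (t1 + t2) * M $$ (i, j)
        + t1 * t2 * (if i = j then 1 else 0) = \<alpha> i * \<alpha> j"
    "proots (char_poly M) = {#t0#} + replicate_mset m t1 + replicate_mset l t2"
    "m + l + 1 = n"
    "(\<Sum>i<n. M $$ (i, i)) = t0 + real m * t1 + real l * t2"
proof -
  have ev: "eigenvalue M e \<longleftrightarrow> e \<in> {t0, t1, t2}" for e
    using spec unfolding spectrum_def by blast
  have top: "e \<le> t0" if "eigenvalue M e" for e
    using that t by (auto simp: ev)
  interpret irreducible_symmetric n M t0
    by (rule irreducible_symmetric.intro[OF M sym nonneg irreducible top])
  obtain u d where
    norm: "\<And>k l. k < n \<Longrightarrow> l < n \<Longrightarrow> (\<Sum>i<n. u k i * u l i) = (if k = l then 1 else 0)"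
    and orth: "\<And>i j. i < n \<Longrightarrow> j < n \<Longrightarrow> (\<Sum>k<n. u k i * u k j) = (if i = j then 1 else 0)"
    and Mud: "\<And>i j. i < n \<Longrightarrow> j < n \<Longrightarrow> M $$ (i, j) = (\<Sum>k<n. d k * u k i * u k j)"
    and cp: "char_poly M = (\<Prod>k<n. [:- d k, 1:])"
    by (rule symmetric_real_spectral_expansion[OF M sym]) (rule that)
  have "eigenvalue M e \<longleftrightarrow> e \<in> d ` {..<n}" for e
    by (auto simp: eigenvalue_root_char_poly[OF M] cp poly_prod)
  then have dset: "d ` {..<n} = {t0, t1, t2}" by (auto simp: ev)
  have eig: "(\<Sum>j<n. M $$ (i, j) * u k j) = d k * u k i" if "i < n" "k < n" for i k
  proof -
    have "(\<Sum>j<n. M $$ (i, j) * u k j) = (\<Sum>j<n. \<Sum>l<n. d l * u l i * (u l j * u k j))"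
      using that by (simp add: Mud sum_distrib_right mult.assoc)
    also have "\<dots> = (\<Sum>l<n. d l * u l i * (\<Sum>j<n. u l j * u k j))"
      by (subst sum.swap) (simp add: sum_distrib_left)
    also have "\<dots> = (\<Sum>l<n. if l = k then d l * u l i else 0)"
      using that by (intro sum.cong) (auto simp: norm)
    also have "\<dots> = d k * u k i" using that by simp
    finally show ?thesis .
  qed
  obtain k0 where k0: "k0 < n" "d k0 = t0"
    using dset by (metis imageE insertI1 lessThan_iff)
  define x where "x = u k0"
  have x: "(\<Sum>j<n. M $$ (i, j) * x j) = t0 * x i" if "i < n" for i
    using eig[OF that k0(1)] k0(2) by (simp add: x_def)
  have xx: "(\<Sum>i<n. x i * x i) = 1"
    using norm[OF k0(1) k0(1)] by (simp add: x_def)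
  have xnz: "x i \<noteq> 0" if "i < n" for i
  proof
    assume "x i = 0"
    then have "x j = 0" if "j < n" for j
      using eigenvector_nowhere_zero[OF x] \<open>i < n\<close> that by blast
    then have "(\<Sum>j<n. x j * x j) = 0" by simp
    with xx show False by simp
  qed
  \<comment> \<open>A second index for \<open>t0\<close> would give a vector \<open>u k\<close>
    proportional to \<open>x\<close> and orthogonal to it, hence zero, against its unit
    norm.\<close>
  have simple: "k = k0" if "k < n" "d k = t0" for k
  proof (rule ccontr)
    assume "k \<noteq> k0"
    have uk: "(\<Sum>j<n. M $$ (i, j) * u k j) = t0 * u k i" if "i < n" for i
      using eig[OF that \<open>k < n\<close>] \<open>d k = t0\<close> by simp
    have "u k i = 0" if "i < n" for i
    proof -
      have "u k i = (\<Sum>j<n. u k i * (x j * x j))"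
        by (simp add: sum_distrib_left[symmetric] xx)
      also have "\<dots> = (\<Sum>j<n. x i * (u k j * u k0 j))"
        using that by (intro sum.cong)
          (auto simp: x_def mult.assoc[symmetric] eigenvector_unique[OF uk x[unfolded x_def]])
      also have "\<dots> = 0"
        using norm[OF \<open>k < n\<close> k0(1)] \<open>k \<noteq> k0\<close> by (simp add: sum_distrib_left[symmetric])
      finally show ?thesis .
    qed
    then have "(\<Sum>i<n. u k i * u k i) = 0" by simp
    with norm[of k k] \<open>k < n\<close> show False by simp
  qed
  \<comment> \<open>Both x and |x| satisfy the equation for \<open>t0\<close>, so they are
    proportional and the entries of x share one sign.\<close>
  have same_sign: "\<bar>x i\<bar> * \<bar>x j\<bar> = x i * x j" if "i < n" "j < n" for i j
  proof -
    have "\<bar>x i\<bar> * x j = x i * \<bar>x j\<bar>"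
      using eigenvector_unique[OF abs_eigenvector[OF x] x that] by simp
    then show ?thesis using xnz that by (auto simp: abs_if split: if_splits)
  qed
  \<comment> \<open>The value at \<open>t0\<close> of the polynomial that vanishes at
    \<open>t1\<close> and \<open>t2\<close>. Scaling the unit vector |x| by sqrt c turns c x x^T
    into \<alpha> \<alpha>^T.\<close>
  define c where "c = (t0 - t1) * (t0 - t2)"
  have c: "c > 0" using t by (simp add: c_def)
  define \<alpha> where "\<alpha> = (\<lambda>i. sqrt c * \<bar>x i\<bar>)"
  have \<alpha>_pos: "\<alpha> i > 0" if "i < n" for i
    using c xnz[OF that] by (simp add: \<alpha>_def)
  have \<alpha>_eig: "(\<Sum>j<n. M $$ (i, j) * \<alpha> j) = t0 * \<alpha> i" if "i < n" for i
    using abs_eigenvector[OF x that]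
    by (simp add: \<alpha>_def mult.left_commute[of _ "sqrt c"] sum_distrib_left[symmetric])
  have square: "(\<Sum>k<n. M $$ (i, k) * M $$ (k, j)) = (\<Sum>k<n. (d k)\<^sup>2 * u k i * u k j)"
    if "i < n" "j < n" for i j
  proof -
    have "(\<Sum>l<n. M $$ (i, l) * M $$ (l, j)) = (\<Sum>l<n. (\<Sum>k<n. d k * u k i * u k l) * M $$ (j, l))"
    proof (intro sum.cong refl)
      fix l assume "l \<in> {..<n}"
      then show "M $$ (i, l) * M $$ (l, j) = (\<Sum>k<n. d k * u k i * u k l) * M $$ (j, l)"
        using that Mud[of i l] symmetric_mat_index[OF sym M, of l j] by simp
    qed
    also have "\<dots> = (\<Sum>l<n. \<Sum>k<n. d k * u k i * (M $$ (j, l) * u k l))"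
      unfolding sum_distrib_right by (intro sum.cong refl) (simp add: mult.commute mult.left_commute)
    also have "\<dots> = (\<Sum>k<n. d k * u k i * (\<Sum>l<n. M $$ (j, l) * u k l))"
      by (subst sum.swap) (simp add: sum_distrib_left)
    also have "\<dots> = (\<Sum>k<n. (d k)\<^sup>2 * u k i * u k j)"
      using that by (intro sum.cong) (auto simp: eig power2_eq_square)
    finally show ?thesis .
  qed
  have rank_one: "(\<Sum>k<n. M $$ (i, k) * M $$ (k, j)) - (t1 + t2) * M $$ (i, j)
        + t1 * t2 * (if i = j then 1 else 0) = \<alpha> i * \<alpha> j" if ij: "i < n" "j < n" for i j
  proof -
    have "(\<Sum>k<n. M $$ (i, k) * M $$ (k, j)) - (t1 + t2) * M $$ (i, j)
        + t1 * t2 * (if i = j then 1 else 0)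
      = (\<Sum>k<n. (d k)\<^sup>2 * u k i * u k j - (t1 + t2) * (d k * u k i * u k j)
          + t1 * t2 * (u k i * u k j))"
      unfolding square[OF ij] Mud[OF ij] orth[OF ij, symmetric] sum.distrib sum_subtractf
        sum_distrib_left ..
    also have "\<dots> = (\<Sum>k<n. (d k - t1) * (d k - t2) * (u k i * u k j))"
      by (intro sum.cong refl) (simp add: power2_eq_square algebra_simps)
    \<comment> \<open>Every index other than \<open>k0\<close> has eigenvalue \<open>t1\<close> or
      \<open>t2\<close> and is annihilated.\<close>
    also have "\<dots> = (\<Sum>k<n. if k = k0 then c * (x i * x j) else 0)"
    proof (intro sum.cong refl)
      fix k assume k: "k \<in> {..<n}"
      have "d k \<in> {t0, t1, t2}" using dset k by blast
      with simple[of k] k have "k \<noteq> k0 \<Longrightarrow> d k = t1 \<or> d k = t2" by auto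
      then show "(d k - t1) * (d k - t2) * (u k i * u k j)
          = (if k = k0 then c * (x i * x j) else 0)"
        by (cases "k = k0") (auto simp: c_def x_def k0)
    qed
    also have "\<dots> = \<alpha> i * \<alpha> j"
    proof -
      have "\<alpha> i * \<alpha> j = (sqrt c * sqrt c) * (\<bar>x i\<bar> * \<bar>x j\<bar>)"
        by (simp add: \<alpha>_def)
      also have "\<dots> = c * (x i * x j)"
        using c by (simp only: same_sign[OF ij] real_sqrt_mult_self abs_of_pos)
      finally show ?thesis using k0 by simp
    qed
    finally show ?thesis .
  qed
  define K1 K2 where "K1 = {k. k < n \<and> d k = t1}" and "K2 = {k. k < n \<and> d k = t2}"
  have fin: "finite K1" "finite K2" by (auto simp: K1_def K2_def)
  have disj: "k0 \<notin> K1" "k0 \<notin> K2" "K1 \<inter> K2 = {}"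
    using t k0 by (auto simp: K1_def K2_def)
  have part: "{..<n} = insert k0 (K1 \<union> K2)"
  proof -
    have "k = k0 \<or> k \<in> K1 \<union> K2" if "k < n" for k
    proof -
      have "d k \<in> {t0, t1, t2}" using dset that by blast
      with simple[of k] that show ?thesis by (auto simp: K1_def K2_def)
    qed
    then show ?thesis using k0 by (auto simp: K1_def K2_def)
  qed
  \<comment> \<open>Stated for any commutative monoid because it serves multisets of roots,
    cardinalities and the trace.\<close>
  have decomp: "(\<Sum>k<n. f k) = f k0 + (\<Sum>k\<in>K1. f k) + (\<Sum>k\<in>K2. f k)"
    for f :: "nat \<Rightarrow> 'z :: comm_monoid_add"
    unfolding part using fin disj by (simp add: sum.union_disjoint add.assoc)
  have "proots (char_poly M) = (\<Sum>k<n. {#d k#})"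
    unfolding cp by (subst proots_prod) auto
  also have "\<dots> = {#t0#} + replicate_mset (card K1) t1 + replicate_mset (card K2) t2"
    unfolding decomp using k0 fin by (auto simp: K1_def K2_def sum_singleton_mset_const)
  finally have roots: "proots (char_poly M)
      = {#t0#} + replicate_mset (card K1) t1 + replicate_mset (card K2) t2" .
  have count: "card K1 + card K2 + 1 = n"
    using decomp[of "\<lambda>_. 1 :: nat"] by simp
  have "(\<Sum>i<n. M $$ (i, i)) = (\<Sum>i<n. \<Sum>k<n. d k * (u k i * u k i))"
    by (simp add: Mud mult.assoc)
  also have "\<dots> = (\<Sum>k<n. d k)"
    by (subst sum.swap) (simp add: sum_distrib_left[symmetric] norm)
  also have "\<dots> = t0 + real (card K1) * t1 + real (card K2) * t2"
    unfolding decomp using k0 by (simp add: K1_def K2_def)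
  finally show ?thesis
    using that[OF \<alpha>_pos \<alpha>_eig rank_one roots count] by simp
qed

section \<open>Adjacency matrices\<close>

lemma pair_graph_arc_sym: "pair_graph G \<Longrightarrow> (u, v) \<in> parcs G \<longleftrightarrow> (v, u) \<in> parcs G"
  using pair_sym_digraph.pair_sym_arcs[of G]
  by (auto simp: pair_graph_def pair_pseudo_graph_def symmetric_def dest: symD)

lemma pair_graph_no_loop: "pair_graph G \<Longrightarrow> (v, v) \<notin> parcs G"
  using pair_loopfree_digraph.pair_no_loops[of G]
  by (fastforce simp: pair_graph_def pair_digraph_def)

lemma pair_graph_arc_verts: "pair_graph G \<Longrightarrow> (u, v) \<in> parcs G \<Longrightarrow> v \<in> pverts G"
  using pair_wf_digraph.in_arcsD2[of G u v]
  by (auto simp: pair_graph_def pair_digraph_def pair_fin_digraph_def)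

text \<open>Connectedness means reachability in the symmetrized digraph, which has the same arcs as
  the symmetric graph G. Induction along a walk that starts in S never leaves S.\<close>

lemma connected_closed_eq_verts:
  assumes G: "pair_graph G" and conn: "connected (with_proj G)"
    and S: "S \<subseteq> pverts G" "S \<noteq> {}"
    and closed: "\<And>u v. u \<in> S \<Longrightarrow> (u, v) \<in> parcs G \<Longrightarrow> v \<in> S"
  shows "S = pverts G"
proof
  obtain u where u: "u \<in> S" using S by blast
  show "pverts G \<subseteq> S"
  proof
    fix v assume "v \<in> pverts G"
    with conn u S have "(u, v) \<in> rtrancl_on (pverts G) (parcs (mk_symmetric (with_proj G)))"
      by (auto simp: connected_def strongly_connected_def reachable_def)
    then show "v \<in> S"
    proof (induction rule: rtrancl_on_induct)
      case base
      show ?case by (rule u)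
    next
      case (step v w)
      then have "(v, w) \<in> parcs G"
        by (auto simp: mk_symmetric_def pair_graph_arc_sym[OF G, of v w])
      with step closed show ?case by blast
    qed
  qed
qed (rule S)

lemma valency_eq_card:
  assumes "pair_graph G"
  shows "valency G v = card {w \<in> pverts G. (v, w) \<in> parcs G}"
proof -
  have "bij_betw snd (out_arcs (with_proj G) v) {w \<in> pverts G. (v, w) \<in> parcs G}"
    using pair_graph_arc_verts[OF assms]
    by (force simp: bij_betw_def inj_on_def out_arcs_def image_iff)
  then show ?thesis
    by (simp add: out_degree_def bij_betw_same_card)
qed

lemma sum_over_ordering:
  assumes "vertex_ordering V vs"
  shows "(\<Sum>j<length vs. f (vs ! j)) = sum f V"
  using assms sum.reindex_bij_betw[OF bij_betw_nth[of vs "{..<length vs}" V]]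
  by (auto simp: vertex_ordering_def)

lemma arc_sum_eq_card:
  assumes "vertex_ordering V vs"
  shows "(\<Sum>j<length vs. if (v, vs ! j) \<in> parcs G then 1 else 0 :: real)
    = real (card {w \<in> V. (v, w) \<in> parcs G})"
proof -
  have "finite V" using assms by (auto simp: vertex_ordering_def)
  then show ?thesis
    by (subst sum_over_ordering[OF assms, of "\<lambda>w. if (v, w) \<in> parcs G then 1 else 0"])
      (simp add: sum.If_cases Int_def)
qed

lemma adjacency_matrix_carrier:
  "adjacency_matrix G vs \<in> carrier_mat (length vs) (length vs)"
  by (simp add: adjacency_matrix_def)

lemma adjacency_matrix_index:
  "i < length vs \<Longrightarrow> j < length vs \<Longrightarrow>
    adjacency_matrix G vs $$ (i, j) = (if (vs ! i, vs ! j) \<in> parcs G then 1 else 0)"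
  by (simp add: adjacency_matrix_def)

lemma adjacency_matrix_symmetric:
  "pair_graph G \<Longrightarrow> transpose_mat (adjacency_matrix G vs) = adjacency_matrix G vs"
  by (rule eq_matI) (auto simp: adjacency_matrix_def pair_graph_arc_sym)

text \<open>The right-hand side concerns functions on vertices and mentions no ordering, so the set
  of eigenvalues does not depend on one.\<close>

lemma adjacency_matrix_eigenvalue_iff:
  assumes "vertex_ordering V vs"
  shows "eigenvalue (adjacency_matrix G vs) e \<longleftrightarrow>
    (\<exists>f. (\<exists>v\<in>V. f v \<noteq> 0) \<and> (\<forall>v\<in>V. (\<Sum>w\<in>V. if (v, w) \<in> parcs G then f w else 0) = e * f v))"
    (is "?L \<longleftrightarrow> ?R")
proof -
  let ?M = "adjacency_matrix G vs" and ?N = "length vs"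
  have dist: "distinct vs" and V: "V = set vs" using assms by (auto simp: vertex_ordering_def)
  have row: "(\<Sum>j<?N. ?M $$ (i, j) * f (vs ! j))
      = (\<Sum>w\<in>V. if (vs ! i, w) \<in> parcs G then f w else 0)" if "i < ?N" for f i
    unfolding sum_over_ordering[OF assms, symmetric]
    using that by (intro sum.cong) (auto simp: adjacency_matrix_index)
  show ?thesis
  proof
    assume ?L
    then obtain g where g: "\<exists>i<?N. g i \<noteq> 0" "\<forall>i<?N. (\<Sum>j<?N. ?M $$ (i, j) * g j) = e * g i"
      by (auto simp: real_eigenvalue_iff[OF adjacency_matrix_carrier])
    define f where "f = g \<circ> the_inv_into {..<?N} ((!) vs)"
    have "inj_on ((!) vs) {..<?N}" using dist by (auto simp: inj_on_def nth_eq_iff_index_eq)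
    then have f: "f (vs ! i) = g i" if "i < ?N" for i
      using that by (simp add: f_def the_inv_into_f_f)
    have "(\<Sum>w\<in>V. if (vs ! i, w) \<in> parcs G then f w else 0) = e * f (vs ! i)" if "i < ?N" for i
      using g(2) that by (simp add: row[symmetric] f)
    moreover have "\<exists>v\<in>V. f v \<noteq> 0" using g(1) f V by (metis nth_mem)
    ultimately show ?R by (intro exI[of _ f]) (auto simp: V in_set_conv_nth)
  next
    assume ?R
    then obtain f where f: "\<exists>v\<in>V. f v \<noteq> 0"
      "\<forall>v\<in>V. (\<Sum>w\<in>V. if (v, w) \<in> parcs G then f w else 0) = e * f v"
      by blast
    have "\<exists>i<?N. f (vs ! i) \<noteq> 0" using f(1) by (auto simp: V in_set_conv_nth)
    moreover have "\<forall>i<?N. (\<Sum>j<?N. ?M $$ (i, j) * f (vs ! j)) = e * f (vs ! i)"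
      using f(2) by (simp add: row V)
    ultimately show ?L
      unfolding real_eigenvalue_iff[OF adjacency_matrix_carrier]
      by (intro exI[of _ "\<lambda>i. f (vs ! i)"] conjI)
  qed
qed

text \<open>The graph class provides the spectrum for some ordering, while the block form of the
  adjacency matrix lists one valency class after the other.\<close>

lemma spectrum_adjacency_matrix_ordering:
  assumes "vertex_ordering V vs" "vertex_ordering V ws"
  shows "spectrum (adjacency_matrix G vs) = spectrum (adjacency_matrix G ws)"
  unfolding spectrum_def
  by (rule Collect_cong, rule trans[OF adjacency_matrix_eigenvalue_iff[OF assms(1)]
        adjacency_matrix_eigenvalue_iff[OF assms(2), symmetric]])

lemma adjacency_matrix_irreducible:
  assumes G: "pair_graph G" and conn: "connected (with_proj G)"
    and vs: "vertex_ordering (pverts G) vs"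
  shows "irreducible_mat (length vs) (adjacency_matrix G vs)"
  unfolding irreducible_mat_def
proof (intro allI impI)
  fix S assume S: "S \<subseteq> {..<length vs}" "S \<noteq> {}"
    and closed: "\<forall>i\<in>S. \<forall>j<length vs. adjacency_matrix G vs $$ (i, j) \<noteq> 0 \<longrightarrow> j \<in> S"
  have dist: "distinct vs" and V: "pverts G = set vs" using vs by (auto simp: vertex_ordering_def)
  have "((!) vs) ` S = pverts G"
  proof (rule connected_closed_eq_verts[OF G conn])
    show "(!) vs ` S \<subseteq> pverts G" "(!) vs ` S \<noteq> {}" using S by (auto simp: V)
    fix u v assume u: "u \<in> (!) vs ` S" and uv: "(u, v) \<in> parcs G"
    obtain i where i: "i \<in> S" "u = vs ! i" using u by blast
    obtain j where j: "j < length vs" "v = vs ! j"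
      using pair_graph_arc_verts[OF G uv] by (auto simp: V in_set_conv_nth)
    have "adjacency_matrix G vs $$ (i, j) \<noteq> 0"
      using i j S uv by (subst adjacency_matrix_index) auto
    then show "v \<in> (!) vs ` S" using closed i j by blast
  qed
  show "S = {..<length vs}"
  proof
    show "{..<length vs} \<subseteq> S"
    proof
      fix j assume j: "j \<in> {..<length vs}"
      then have "vs ! j \<in> (!) vs ` S" using \<open>(!) vs ` S = pverts G\<close> by (auto simp: V)
      then obtain i where "i \<in> S" "vs ! i = vs ! j" by auto
      with dist j S show "j \<in> S" by (auto simp: nth_eq_iff_index_eq)
    qed
  qed (rule S)
qed

lemma average_neighbours_const:
  assumes "finite U" "U \<noteq> {}" "\<And>u. u \<in> U \<Longrightarrow> real (card {w \<in> W. (u, w) \<in> parcs G}) = r"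
  shows "average_neighbours G U W = r"
  using assms by (simp add: average_neighbours_def)

section \<open>Matrices with constant row sums\<close>

lemma row_sum_eigenvalue:
  assumes "X \<in> carrier_mat n n" "n > 0" "\<And>i. i < n \<Longrightarrow> (\<Sum>j<n. X $$ (i, j)) = r"
  shows "eigenvalue X (r :: real)"
  unfolding real_eigenvalue_iff[OF assms(1)] using assms(2,3) by (intro exI[of _ "\<lambda>_. 1"]) auto

text \<open>Evaluate the eigenvalue equation at an index where |f| attains its maximum m: this gives
  |e| m \<le> r m.\<close>

lemma eigenvalue_le_row_sum:
  assumes X: "X \<in> carrier_mat n n" and nonneg: "\<And>i j. i < n \<Longrightarrow> j < n \<Longrightarrow> X $$ (i, j) \<ge> 0"
    and rows: "\<And>i. i < n \<Longrightarrow> (\<Sum>j<n. X $$ (i, j)) = r" and ev: "eigenvalue X e"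
  shows "\<bar>e\<bar> \<le> (r :: real)"
proof -
  obtain f i0 where i0: "i0 < n" "f i0 \<noteq> 0"
    and f: "\<And>i. i < n \<Longrightarrow> (\<Sum>j<n. X $$ (i, j) * f j) = e * f i"
    using ev unfolding real_eigenvalue_iff[OF X] by blast
  define m where "m = Max ((\<lambda>i. \<bar>f i\<bar>) ` {..<n})"
  have m: "\<bar>f i\<bar> \<le> m" if "i < n" for i
    unfolding m_def using that by (intro Max_ge) auto
  have "m \<in> (\<lambda>i. \<bar>f i\<bar>) ` {..<n}"
    unfolding m_def using i0 by (intro Max_in) auto
  then obtain i where i: "i < n" "m = \<bar>f i\<bar>" by auto
  have "m > 0" using m[OF i0(1)] i0(2) by linarith
  have "\<bar>e\<bar> * m = \<bar>\<Sum>j<n. X $$ (i, j) * f j\<bar>"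
    using f[OF i(1)] i(2) by (simp add: abs_mult)
  also have "\<dots> \<le> (\<Sum>j<n. \<bar>X $$ (i, j) * f j\<bar>)" by (rule sum_abs)
  also have "\<dots> \<le> (\<Sum>j<n. X $$ (i, j) * m)"
    using nonneg i(1) m by (intro sum_mono) (auto simp: abs_mult intro!: mult_left_mono)
  also have "\<dots> = r * m" using rows[OF i(1)] by (simp add: sum_distrib_right[symmetric])
  finally show ?thesis using \<open>m > 0\<close> by simp
qed

lemma cospectral_eigenvalue_iff:
  assumes "X \<in> carrier_mat n n" "Y \<in> carrier_mat m m" "cospectral X Y"
  shows "eigenvalue X e \<longleftrightarrow> eigenvalue Y e"
proof -
  \<comment> \<open>Only for nonzero polynomials is the support of \<open>proots\<close> the set of
    roots.\<close>
  have "char_poly X \<noteq> 0" "char_poly Y \<noteq> 0"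
    using degree_monic_char_poly[OF assms(1)] degree_monic_char_poly[OF assms(2)] by auto
  then have "{e. poly (char_poly X) e = 0} = {e. poly (char_poly Y) e = 0}"
    using assms(3) unfolding cospectral_def eigenvalue_mset_def by (metis set_count_proots)
  then show ?thesis
    unfolding eigenvalue_root_char_poly[OF assms(1)] eigenvalue_root_char_poly[OF assms(2)] by blast
qed

text \<open>For a nonnegative matrix the constant row sum is the largest eigenvalue, which
  cospectral matrices share.\<close>

lemma cospectral_row_sums_eq:
  assumes X: "X \<in> carrier_mat n n" and Y: "Y \<in> carrier_mat n n" and n: "n > 0"
    and X0: "\<And>i j. i < n \<Longrightarrow> j < n \<Longrightarrow> X $$ (i, j) \<ge> 0"
    and Y0: "\<And>i j. i < n \<Longrightarrow> j < n \<Longrightarrow> Y $$ (i, j) \<ge> 0"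
    and Xr: "\<And>i. i < n \<Longrightarrow> (\<Sum>j<n. X $$ (i, j)) = r"
    and Yr: "\<And>i. i < n \<Longrightarrow> (\<Sum>j<n. Y $$ (i, j)) = s"
    and cosp: "cospectral X Y"
  shows "r = s"
proof (rule antisym)
  have "eigenvalue X r" by (rule row_sum_eigenvalue[OF X n Xr])
  moreover have "eigenvalue Y s" by (rule row_sum_eigenvalue[OF Y n Yr])
  ultimately have "eigenvalue Y r" "eigenvalue X s"
    using cospectral_eigenvalue_iff[OF X Y cosp] by auto
  then have "\<bar>r\<bar> \<le> s" "\<bar>s\<bar> \<le> r"
    using eigenvalue_le_row_sum[OF Y Y0 Yr] eigenvalue_le_row_sum[OF X X0 Xr] by auto
  then show "r \<le> s" "s \<le> r" by auto
qed

section \<open>Two valency classes of equal size\<close>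

lemma eigenvalue_mat2_iff:
  fixes p q r s :: real
  shows "eigenvalue (mat_of_rows_list 2 [[p, q], [r, s]]) e \<longleftrightarrow> (p - e) * (s - e) = q * r"
proof -
  let ?M = "mat_of_rows_list 2 [[p, q], [r, s]]"
  have M: "?M \<in> carrier_mat 2 2" by (intro carrier_matI) (auto simp: mat_of_rows_list_def)
  have ev: "eigenvalue ?M e \<longleftrightarrow>
    (\<exists>f. (f 0 \<noteq> 0 \<or> f 1 \<noteq> 0) \<and> p * f 0 + q * f 1 = e * f 0 \<and> r * f 0 + s * f 1 = e * f (1 :: nat))"
  proof -
    have "(\<exists>i<2. P i) \<longleftrightarrow> P 0 \<or> P 1" "(\<forall>i<2. P i) \<longleftrightarrow> P 0 \<and> P 1" for P :: "nat \<Rightarrow> bool"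
      by (auto simp: less_2_cases_iff)
    moreover have "(\<Sum>j<2. h j) = h 0 + h 1" for h :: "nat \<Rightarrow> real"
      by (simp add: numeral_2_eq_2)
    ultimately show ?thesis
      unfolding real_eigenvalue_iff[OF M] by (simp add: mat_of_rows_list_def)
  qed
  show ?thesis
  proof
    assume "eigenvalue ?M e"
    then obtain x y where xy: "x \<noteq> 0 \<or> y \<noteq> 0" "p * x + q * y = e * x" "r * x + s * y = e * y"
      unfolding ev by blast
    \<comment> \<open>Multiplication by the adjugate of M - eI: the determinant annihilates both
      coordinates of an eigenvector.\<close>
    have "((p - e) * (s - e) - q * r) * x
        = (s - e) * (p * x + q * y - e * x) - q * (r * x + s * y - e * y)"
      "((p - e) * (s - e) - q * r) * y
        = (p - e) * (r * x + s * y - e * y) - r * (p * x + q * y - e * x)"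
      by (simp_all add: algebra_simps)
    with xy(2,3) have "((p - e) * (s - e) - q * r) * x = 0" "((p - e) * (s - e) - q * r) * y = 0"
      by simp_all
    with xy(1) show "(p - e) * (s - e) = q * r" by auto
  next
    assume det: "(p - e) * (s - e) = q * r"
    \<comment> \<open>A nonzero row of the singular matrix M - eI determines a kernel vector
      orthogonal to it; if both rows vanish, any vector will do.\<close>
    consider "p \<noteq> e \<or> q \<noteq> 0" | "r \<noteq> 0 \<or> s \<noteq> e" | "p = e" "q = 0" "r = 0" "s = e" by blast
    then show "eigenvalue ?M e"
    proof cases
      case 1
      with det show ?thesis unfolding ev
        by (intro exI[of _ "\<lambda>i. if i = 0 then q else e - p"]) (auto simp: algebra_simps)
    next
      case 2
      with det show ?thesis unfolding ev
        by (intro exI[of _ "\<lambda>i. if i = 0 then e - s else r"]) (auto simp: algebra_simps)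
    next
      case 3
      then show ?thesis unfolding ev by (intro exI[of _ "\<lambda>_. 1"]) auto
    qed
  qed
qed

lemma sum_lessThan_add:
  "(\<Sum>k<m + n. f k) = (\<Sum>k<m. f k) + (\<Sum>k<n. f (m + k))" for f :: "nat \<Rightarrow> 'a :: comm_monoid_add"
  by (induction n) (auto simp: add.assoc)

text \<open>Here \<open>s\<close> and \<open>p\<close> stand for the sum and product of the two
  smaller eigenvalues, and \<open>N\<close> for the class size. Subtracting \<open>row22\<close>
  from \<open>row11\<close> leaves the factor k11 - k22 = a^2 - b^2, which is nonzero; cancelling it
  gives k11 + k22 = s + N, to be compared with \<open>compl\<close>.\<close>

lemma two_valency_parameters:
  fixes a b k11 k12 k22 s p t0 N :: real
  assumes "a > 0" "b > 0" "a \<noteq> b" "N \<noteq> 0"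
    and a2: "a\<^sup>2 = k11 + k12 + p" and b2: "b\<^sup>2 = k12 + k22 + p"
    and eig: "k11 * a + k12 * b = t0 * a" and compl: "k11 + k22 = N - 1"
    and row11: "k11\<^sup>2 + k12\<^sup>2 - s * k11 + p = N * a\<^sup>2"
    and row22: "k12\<^sup>2 + k22\<^sup>2 - s * k22 + p = N * b\<^sup>2"
    and row21: "k12 * k11 + k22 * k12 - s * k12 = N * (b * a)"
  shows "s = - 1" "k12 = a * b" "t0 = k11 + b\<^sup>2" "k22 = k11 - a\<^sup>2 + b\<^sup>2"
proof -
  have "k11 \<noteq> k22"
  proof
    assume "k11 = k22"
    with a2 b2 have "a\<^sup>2 = b\<^sup>2" by simp
    with assms(1-3) show False by (simp add: power2_eq_iff)
  qed
  moreover have "(k11 - k22) * (k11 + k22 - s - N) = 0"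
  proof -
    have "k11\<^sup>2 - k22\<^sup>2 - s * (k11 - k22) = N * (a\<^sup>2 - b\<^sup>2)"
      using row11 row22 by (simp add: algebra_simps)
    moreover have "a\<^sup>2 - b\<^sup>2 = k11 - k22" using a2 b2 by simp
    ultimately have "k11\<^sup>2 - k22\<^sup>2 - s * (k11 - k22) = N * (k11 - k22)" by simp
    then show ?thesis by (simp add: power2_eq_square algebra_simps)
  qed
  ultimately show s: "s = - 1" using compl by simp
  \<comment> \<open>Now k11 + k22 - s = N, so \<open>row21\<close> reduces to N k12 = N a b.\<close>
  have "N * k12 = k12 * (k11 + k22) - s * k12" unfolding compl s by (simp add: algebra_simps)
  also have "\<dots> = N * (a * b)" using row21 by (simp add: algebra_simps)
  finally have "N * k12 = N * (a * b)" .
  then show k12: "k12 = a * b" using assms(4) by simp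
  have "(k11 + b\<^sup>2) * a = t0 * a" using eig k12 by (simp add: power2_eq_square algebra_simps)
  then show "t0 = k11 + b\<^sup>2" using assms(1) by simp
  show "k22 = k11 - a\<^sup>2 + b\<^sup>2" using a2 b2 by simp
qed

text \<open>Swapping the sums pulls out \<open>c\<close>. This evaluates a row sum of a product of
  blocks with constant row sums.\<close>

lemma sum_matrix_product:
  fixes c :: real
  assumes "\<And>k. k < n \<Longrightarrow> (\<Sum>j<n. g k j) = c"
  shows "(\<Sum>j<n. \<Sum>k<n. f k * g k j) = (\<Sum>k<n. f k) * c"
  unfolding sum_distrib_right
  by (subst sum.swap) (intro sum.cong refl, simp add: assms sum_distrib_left[symmetric])

text \<open>The product is (tI - X)((t+1)I - J + X) = t(t+1)I - tJ - X + XJ - X^2, and the entries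
  of XJ are the row sums of X.\<close>

lemma complement_product_index:
  fixes X :: "real mat"
  assumes X: "X \<in> carrier_mat n n" and ij: "i < n" "j < n"
  shows "((t \<cdot>\<^sub>m 1\<^sub>m n - X) * (t \<cdot>\<^sub>m 1\<^sub>m n - (all_ones_mat n - 1\<^sub>m n - X))) $$ (i, j)
    = t * (t + 1) * (if i = j then 1 else 0) - t - X $$ (i, j) + (\<Sum>k<n. X $$ (i, k))
      - (\<Sum>k<n. X $$ (i, k) * X $$ (k, j))"
proof -
  have "((t \<cdot>\<^sub>m 1\<^sub>m n - X) * (t \<cdot>\<^sub>m 1\<^sub>m n - (all_ones_mat n - 1\<^sub>m n - X))) $$ (i, j)
    = (\<Sum>k<n. (t \<cdot>\<^sub>m 1\<^sub>m n - X) $$ (i, k) * (t \<cdot>\<^sub>m 1\<^sub>m n - (all_ones_mat n - 1\<^sub>m n - X)) $$ (k, j))"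
    using X ij by (intro mult_mat_index[of _ n n _ n]) (auto simp: all_ones_mat_def)
  also have "\<dots> = (\<Sum>k<n.
      (if k = i then t * ((t + 1) * (if i = j then 1 else 0) - 1 + X $$ (i, j)) else 0)
      - (if k = j then (t + 1) * X $$ (i, j) else 0)
      + X $$ (i, k) - X $$ (i, k) * X $$ (k, j))"
    using X ij by (intro sum.cong) (auto simp: all_ones_mat_def algebra_simps)
  also have "\<dots> = t * ((t + 1) * (if i = j then 1 else 0) - 1 + X $$ (i, j)) - (t + 1) * X $$ (i, j)
      + (\<Sum>k<n. X $$ (i, k)) - (\<Sum>k<n. X $$ (i, k) * X $$ (k, j))"
    using ij by (simp add: sum.distrib sum_subtractf)
  finally show ?thesis by (simp add: algebra_simps)
qed

theorem lemma7p6: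
  fixes G :: "'a pair_pre_digraph"
    and \<theta>0 \<theta>1 \<theta>2 k11 k12 k21 k22 :: real
    and k1 k2 n :: nat
    and V1 V2 :: "'a set"
    and vs1 vs2 :: "'a list"
    and A A1 A2 B Q J I :: "real mat"
  assumes "\<theta>0 > \<theta>1" and "\<theta>1 > \<theta>2"
    and "G \<in> three_eigenvalue_graphs \<theta>0 \<theta>1 \<theta>2"
    and "valency G ` pverts G = {k1, k2}" and "k1 > k2"
    and "V1 = valency_class G k1" and "V2 = valency_class G k2"
    and "card V1 = n" and "card V2 = n"
    and "vertex_ordering V1 vs1" and "vertex_ordering V2 vs2"
    and "A = adjacency_matrix G (vs1 @ vs2)"
    and "A1 \<in> carrier_mat n n" and "A2 \<in> carrier_mat n n" and "B \<in> carrier_mat n n"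
    and "A = four_block_mat A1 (transpose_mat B) B A2"
    and "k11 = average_neighbours G V1 V1" and "k12 = average_neighbours G V1 V2"
    and "k21 = average_neighbours G V2 V1" and "k22 = average_neighbours G V2 V2"
    and "Q = mat_of_rows_list 2 [[k11, k12], [k21, k22]]"
    and "J = all_ones_mat n" and "I = 1\<^sub>m n"
    and "cospectral A1 (J - I - A2)"
  shows "k12 = k21 \<and>
    B * A1 = (J - I - A2) * B \<and>
    (\<exists>\<theta> \<in> {\<theta>1, \<theta>2}.
       spectrum Q = {\<theta>0, \<theta>} \<and>
       eigenvalue_mset A =
         {#\<theta>0#} + replicate_mset n \<theta> + replicate_mset (n - 1) (- \<theta> - 1) \<and>
       transpose_mat B * B = (\<theta> \<cdot>\<^sub>m I - A1) * (\<theta> \<cdot>\<^sub>m I - (J - I - A1)) \<and>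
       B * transpose_mat B = (\<theta> \<cdot>\<^sub>m I - A2) * (\<theta> \<cdot>\<^sub>m I - (J - I - A2)))"
proof -

  \<comment> \<open>The two valency classes and their common ordering\<close>
  note \<theta> = assms(1,2) and V1 = assms(6) and V2 = assms(7) and vs1 = assms(10) and vs2 = assms(11)
    and A_def = assms(12) and A1 = assms(13) and A2 = assms(14) and B = assms(15)
    and block = assms(16) and J = assms(22) and I = assms(23) and cosp = assms(24)
  define vs where "vs = vs1 @ vs2"
  obtain vs0 where G: "pair_graph G" and conn: "connected (with_proj G)"
    and vs0: "vertex_ordering (pverts G) vs0"
    and spec0: "spectrum (adjacency_matrix G vs0) = {\<theta>0, \<theta>1, \<theta>2}"
    using assms(3) by (auto simp: three_eigenvalue_graphs_def)
  have V12: "V1 \<union> V2 = pverts G" "V1 \<inter> V2 = {}"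
    using assms(4,5) by (auto simp: V1 V2 valency_class_def)
  have vs: "vertex_ordering (pverts G) vs"
    using vs1 vs2 V12 by (auto simp: vs_def vertex_ordering_def)
  have len1: "length vs1 = n" and len2: "length vs2 = n"
    using vs1 vs2 assms(8,9) by (auto simp: vertex_ordering_def distinct_card[symmetric])
  then have len: "length vs = n + n" by (simp add: vs_def)
  have nth1: "vs ! i = vs1 ! i" "vs1 ! i \<in> V1" if "i < n" for i
    using that len1 vs1 by (auto simp: vs_def nth_append vertex_ordering_def)
  have nth2: "vs ! (n + i) = vs2 ! i" "vs2 ! i \<in> V2" if "i < n" for i
    using that len1 len2 vs2 by (auto simp: vs_def nth_append vertex_ordering_def)
  have fin: "finite V1" "finite V2"
    using vs1 vs2 by (auto simp: vertex_ordering_def)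
  have "k1 \<in> valency G ` pverts G" using assms(4) by simp
  then have "V1 \<noteq> {}" by (auto simp: V1 valency_class_def)
  then have n: "n > 0" using assms(8) fin by (auto simp: card_gt_0_iff)
  then have "V2 \<noteq> {}" using assms(9) by auto

  \<comment> \<open>The adjacency matrix and its positive eigenvector\<close>
  have A: "A \<in> carrier_mat (n + n) (n + n)"
    using adjacency_matrix_carrier[of G vs] by (simp add: A_def vs_def len1 len2)
  have Aidx: "A $$ (i, j) = (if (vs ! i, vs ! j) \<in> parcs G then 1 else 0)"
    if "i < n + n" "j < n + n" for i j
    using that adjacency_matrix_index[of i vs j G] by (simp add: A_def vs_def[symmetric] len)
  have Asym: "transpose_mat A = A"
    unfolding A_def by (rule adjacency_matrix_symmetric[OF G])
  have spec: "spectrum A = {\<theta>0, \<theta>1, \<theta>2}"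
    unfolding A_def vs_def[symmetric] spec0[symmetric]
    by (rule spectrum_adjacency_matrix_ordering[OF vs vs0])
  have irr: "irreducible_mat (n + n) A"
    using adjacency_matrix_irreducible[OF G conn vs] by (simp add: A_def vs_def[symmetric] len)
  have Anonneg: "A $$ (i, j) \<ge> 0" if "i < n + n" "j < n + n" for i j
    using that by (simp add: Aidx)
  define s p where "s = \<theta>1 + \<theta>2" and "p = \<theta>1 * \<theta>2"
  obtain \<alpha> m l where
    \<alpha>_pos: "\<And>i. i < n + n \<Longrightarrow> \<alpha> i > 0"
    and \<alpha>_eig: "\<And>i. i < n + n \<Longrightarrow> (\<Sum>j<n + n. A $$ (i, j) * \<alpha> j) = \<theta>0 * \<alpha> i"
    and rank_one: "\<And>i j. i < n + n \<Longrightarrow> j < n + n \<Longrightarrow>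
      (\<Sum>k<n + n. A $$ (i, k) * A $$ (k, j)) - (\<theta>1 + \<theta>2) * A $$ (i, j)
        + \<theta>1 * \<theta>2 * (if i = j then 1 else 0) = \<alpha> i * \<alpha> j"
    and roots: "proots (char_poly A) = {#\<theta>0#} + replicate_mset m \<theta>1 + replicate_mset l \<theta>2"
    and ml: "m + l + 1 = n + n"
    and trace: "(\<Sum>i<n + n. A $$ (i, i)) = \<theta>0 + real m * \<theta>1 + real l * \<theta>2"
    by (rule three_eigenvalues_perron[OF A Asym _ irr spec \<theta>]) (rule Anonneg, assumption+, rule that)

  \<comment> \<open>Entries of the blocks and values of the eigenvector\<close>
  have A1idx: "A1 $$ (i, j) = A $$ (i, j)" and BTidx: "B $$ (j, i) = A $$ (i, n + j)"
    and Bidx: "B $$ (i, j) = A $$ (n + i, j)" and A2idx: "A2 $$ (i, j) = A $$ (n + i, n + j)"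
    if "i < n" "j < n" for i j
    using that A1 A2 B by (auto simp: block)
  have row: "(\<Sum>j<n + n. A $$ (i, j)) = real (valency G (vs ! i))" if "i < n + n" for i
    unfolding valency_eq_card[OF G] arc_sum_eq_card[OF vs, symmetric] len
    using that by (intro sum.cong) (auto simp: Aidx)
  have diag: "A $$ (i, i) = 0" if "i < n + n" for i
    using that pair_graph_no_loop[OF G] by (simp add: Aidx)
  \<comment> \<open>The diagonal of the rank-one equation: A^2 has the valencies there and A has
    zeros. As \<alpha> is positive, it depends on the valency only.\<close>
  have \<alpha>_square: "(\<alpha> i)\<^sup>2 = real (valency G (vs ! i)) + p" if i: "i < n + n" for i
  proof -
    have "(\<Sum>k<n + n. A $$ (i, k) * A $$ (k, i)) = (\<Sum>k<n + n. A $$ (i, k))"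
      using i by (intro sum.cong refl) (auto simp: Aidx pair_graph_arc_sym[OF G, of "vs ! i"])
    with rank_one[OF i i] show ?thesis
      by (simp add: row[OF i] diag[OF i] p_def power2_eq_square)
  qed
  define a b where "a = sqrt (real k1 + p)" and "b = sqrt (real k2 + p)"
  have val1: "valency G (vs ! i) = k1" if "i < n" for i
    using nth1[OF that] by (simp add: V1 valency_class_def)
  have val2: "valency G (vs ! (n + i)) = k2" if "i < n" for i
    using nth2[OF that] by (simp add: V2 valency_class_def)
  have \<alpha>1: "\<alpha> i = a" if "i < n" for i
    using \<alpha>_square[of i] \<alpha>_pos[of i] val1[OF that] that
    unfolding a_def by (intro real_sqrt_unique[symmetric]) auto
  have \<alpha>2: "\<alpha> (n + i) = b" if "i < n" for i
    using \<alpha>_square[of "n + i"] \<alpha>_pos[of "n + i"] val2[OF that] that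
    unfolding b_def by (intro real_sqrt_unique[symmetric]) auto
  have a: "a > 0" "a\<^sup>2 = real k1 + p"
    using \<alpha>_pos[of 0] \<alpha>_square[of 0] \<alpha>1[of 0] val1[of 0] n by auto
  have b: "b > 0" "b\<^sup>2 = real k2 + p"
    using \<alpha>_pos[of "n + 0"] \<alpha>_square[of "n + 0"] \<alpha>2[of 0] val2[of 0] n by auto
  have ab: "a \<noteq> b" using assms(5) a(2) b(2) by auto

  \<comment> \<open>Equitability of the valency partition\<close>
  have sum11: "(\<Sum>j<n. A1 $$ (i, j)) = real (card {w \<in> V1. (vs1 ! i, w) \<in> parcs G})"
    and sum12: "(\<Sum>j<n. B $$ (j, i)) = real (card {w \<in> V2. (vs1 ! i, w) \<in> parcs G})"
    if i: "i < n" for i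
    unfolding arc_sum_eq_card[OF vs1, symmetric] arc_sum_eq_card[OF vs2, symmetric] len1 len2
    using i nth1 nth2 by (auto intro!: sum.cong simp: A1idx BTidx[OF i] Aidx)
  have sum21: "(\<Sum>j<n. B $$ (i, j)) = real (card {w \<in> V1. (vs2 ! i, w) \<in> parcs G})"
    and sum22: "(\<Sum>j<n. A2 $$ (i, j)) = real (card {w \<in> V2. (vs2 ! i, w) \<in> parcs G})"
    if i: "i < n" for i
    unfolding arc_sum_eq_card[OF vs1, symmetric] arc_sum_eq_card[OF vs2, symmetric] len1 len2
    using i nth1 nth2 by (auto intro!: sum.cong simp: Bidx A2idx Aidx)
  have class1: "(\<Sum>j<n. A1 $$ (i, j)) + (\<Sum>j<n. B $$ (j, i)) = real k1"
    "(\<Sum>j<n. A1 $$ (i, j)) * a + (\<Sum>j<n. B $$ (j, i)) * b = \<theta>0 * a" if i: "i < n" for i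
  proof -
    show "(\<Sum>j<n. A1 $$ (i, j)) + (\<Sum>j<n. B $$ (j, i)) = real k1"
      using row[of i] val1[OF i] i by (simp add: sum_lessThan_add A1idx BTidx[OF i])
    show "(\<Sum>j<n. A1 $$ (i, j)) * a + (\<Sum>j<n. B $$ (j, i)) * b = \<theta>0 * a"
      using \<alpha>_eig[of i] i
      by (simp add: sum_lessThan_add A1idx BTidx[OF i] \<alpha>1 \<alpha>2 sum_distrib_right)
  qed
  have class2: "(\<Sum>j<n. B $$ (i, j)) + (\<Sum>j<n. A2 $$ (i, j)) = real k2"
    "(\<Sum>j<n. B $$ (i, j)) * a + (\<Sum>j<n. A2 $$ (i, j)) * b = \<theta>0 * b" if i: "i < n" for i
  proof -
    show "(\<Sum>j<n. B $$ (i, j)) + (\<Sum>j<n. A2 $$ (i, j)) = real k2"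
      using row[of "n + i"] val2[OF i] i by (simp add: sum_lessThan_add Bidx A2idx)
    show "(\<Sum>j<n. B $$ (i, j)) * a + (\<Sum>j<n. A2 $$ (i, j)) * b = \<theta>0 * b"
      using \<alpha>_eig[of "n + i"] i
      by (simp add: sum_lessThan_add Bidx A2idx \<alpha>1 \<alpha>2 sum_distrib_right)
  qed
  \<comment> \<open>For each vertex the valency and the eigenvalue equation form a linear system in
    its two block row sums, nonsingular since \<open>a\<close> and \<open>b\<close> differ. The
    solution is the same throughout a class, hence equal to the average.\<close>
  have solve: "x = (r * b - q) / (b - a) \<and> y = (q - r * a) / (b - a)"
    if "x + y = r" "x * a + y * b = q" for x y r q :: real
    using that ab by (auto simp: field_simps)
  have avg: "average_neighbours G (set us) W = r"
    if "\<And>i. i < n \<Longrightarrow> real (card {w \<in> W. (us ! i, w) \<in> parcs G}) = r" "length us = n" for us W r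
    using that n by (intro average_neighbours_const) (auto simp: in_set_conv_nth)
  have set12: "V1 = set vs1" "V2 = set vs2"
    using vs1 vs2 by (auto simp: vertex_ordering_def)
  have row11: "(\<Sum>j<n. A1 $$ (i, j)) = k11" and row12: "(\<Sum>j<n. B $$ (j, i)) = k12"
    and row21: "(\<Sum>j<n. B $$ (i, j)) = k21" and row22: "(\<Sum>j<n. A2 $$ (i, j)) = k22"
    if i: "i < n" for i
  proof -
    have c1: "(\<Sum>j<n. A1 $$ (i, j)) = (real k1 * b - \<theta>0 * a) / (b - a)"
      "(\<Sum>j<n. B $$ (j, i)) = (\<theta>0 * a - real k1 * a) / (b - a)" if "i < n" for i
      using solve[OF class1[OF that]] by auto
    have c2: "(\<Sum>j<n. B $$ (i, j)) = (real k2 * b - \<theta>0 * b) / (b - a)"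
      "(\<Sum>j<n. A2 $$ (i, j)) = (\<theta>0 * b - real k2 * a) / (b - a)" if "i < n" for i
      using solve[OF class2[OF that]] by auto
    show "(\<Sum>j<n. A1 $$ (i, j)) = k11" "(\<Sum>j<n. B $$ (j, i)) = k12"
      "(\<Sum>j<n. B $$ (i, j)) = k21" "(\<Sum>j<n. A2 $$ (i, j)) = k22"
      using c1 c2 sum11 sum12 sum21 sum22 i len1 len2
      by (simp_all add: assms(17-20) set12 avg)
  qed
  \<comment> \<open>Double counting of the edges between the classes: n k12 = n k21.\<close>
  have "(\<Sum>i<n. \<Sum>j<n. B $$ (j, i)) = (\<Sum>j<n. \<Sum>i<n. B $$ (j, i))" by (rule sum.swap)
  then have k12_eq: "k12 = k21" using n by (simp add: row12 row21)

  \<comment> \<open>The complement on \<open>V2\<close> and the use of cospectrality\<close>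
  let ?C = "J - I - A2"
  have C: "?C \<in> carrier_mat n n" by (intro minus_carrier_mat A2)
  have Cidx: "?C $$ (i, j) = 1 - (if i = j then 1 else 0) - A2 $$ (i, j)" if "i < n" "j < n" for i j
    using that A2 by (simp add: J I all_ones_mat_def)
  have Crow: "(\<Sum>j<n. ?C $$ (i, j)) = real n - 1 - k22" if i: "i < n" for i
  proof -
    have "(\<Sum>j<n. ?C $$ (i, j)) = (\<Sum>j<n. 1 - (if i = j then 1 else 0) - A2 $$ (i, j))"
      using i by (intro sum.cong) (auto simp: Cidx)
    with i show ?thesis by (simp add: sum_subtractf row22)
  qed
  \<comment> \<open>\<open>?C\<close> is the adjacency matrix of the complement of the graph induced
    on \<open>V2\<close>, so it is nonnegative with constant row sums, as is
    \<open>A1\<close>.\<close>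
  have "k11 = real n - 1 - k22"
  proof (rule cospectral_row_sums_eq[OF A1 C n _ _ row11 Crow cosp])
    fix i j assume ij: "i < n" "j < n"
    then show "A1 $$ (i, j) \<ge> 0" by (simp add: A1idx Aidx)
    show "?C $$ (i, j) \<ge> 0"
      using ij pair_graph_no_loop[OF G] by (simp add: Cidx A2idx Aidx)
  qed
  then have compl: "k11 + k22 = real n - 1" by simp

  \<comment> \<open>Blocks of the rank-one equation and the parameters\<close>
  have rank11: "(\<Sum>k<n. A1 $$ (i, k) * A1 $$ (k, j)) + (\<Sum>k<n. B $$ (k, i) * B $$ (k, j))
      - s * A1 $$ (i, j) + p * (if i = j then 1 else 0) = a\<^sup>2" if "i < n" "j < n" for i j
    using rank_one[of i j] that
    by (simp add: sum_lessThan_add A1idx BTidx[of i] Bidx[of _ j] \<alpha>1 s_def p_def power2_eq_square)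
  have rank21: "(\<Sum>k<n. B $$ (i, k) * A1 $$ (k, j)) + (\<Sum>k<n. A2 $$ (i, k) * B $$ (k, j))
      - s * B $$ (i, j) = b * a" if "i < n" "j < n" for i j
    using rank_one[of "n + i" j] that
    by (simp add: sum_lessThan_add A1idx Bidx A2idx \<alpha>1 \<alpha>2 s_def p_def)
  have rank22: "(\<Sum>k<n. B $$ (i, k) * B $$ (j, k)) + (\<Sum>k<n. A2 $$ (i, k) * A2 $$ (k, j))
      - s * A2 $$ (i, j) + p * (if i = j then 1 else 0) = b\<^sup>2" if "i < n" "j < n" for i j
    using rank_one[of "n + i" "n + j"] that
    by (simp add: sum_lessThan_add Bidx[of i] BTidx[of _ j] A2idx \<alpha>2 s_def p_def power2_eq_square)

  \<comment> \<open>Row 0 represents all rows of its block; summing it turns matrix products into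
    products of quotient entries.\<close>
  have "(\<Sum>j<n. (\<Sum>k<n. A1 $$ (0, k) * A1 $$ (k, j)) + (\<Sum>k<n. B $$ (k, 0) * B $$ (k, j))
      - s * A1 $$ (0, j) + p * (if 0 = j then 1 else 0)) = (\<Sum>j<n. a\<^sup>2)"
    using n by (intro sum.cong refl rank11) auto
  then have q11: "k11\<^sup>2 + k12\<^sup>2 - s * k11 + p = real n * a\<^sup>2"
    using n by (simp add: sum.distrib sum_subtractf sum_matrix_product row11 row12 row21
        sum_distrib_left[symmetric] k12_eq power2_eq_square)
  have "(\<Sum>j<n. (\<Sum>k<n. B $$ (0, k) * A1 $$ (k, j)) + (\<Sum>k<n. A2 $$ (0, k) * B $$ (k, j))
      - s * B $$ (0, j)) = (\<Sum>j<n. b * a)"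
    using n by (intro sum.cong refl rank21) auto
  then have q21: "k12 * k11 + k22 * k12 - s * k12 = real n * (b * a)"
    using n by (simp add: sum.distrib sum_subtractf sum_matrix_product row11 row21 row22
        sum_distrib_left[symmetric] k12_eq)
  have "(\<Sum>j<n. (\<Sum>k<n. B $$ (0, k) * B $$ (j, k)) + (\<Sum>k<n. A2 $$ (0, k) * A2 $$ (k, j))
      - s * A2 $$ (0, j) + p * (if 0 = j then 1 else 0)) = (\<Sum>j<n. b\<^sup>2)"
    using n by (intro sum.cong refl rank22) auto
  then have q22: "k12\<^sup>2 + k22\<^sup>2 - s * k22 + p = real n * b\<^sup>2"
    using n by (simp add: sum.distrib sum_subtractf row12 row21 row22
        sum_matrix_product[where g = "\<lambda>k j. B $$ (j, k)"] sum_matrix_product[where g = "\<lambda>k j. A2 $$ (k, j)"]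
        sum_distrib_left[symmetric] k12_eq power2_eq_square)
  have a2: "a\<^sup>2 = k11 + k12 + p" and b2: "b\<^sup>2 = k12 + k22 + p" and eig: "k11 * a + k12 * b = \<theta>0 * a"
    using class1[OF n] class2[OF n] n by (simp_all add: row11 row12 row21 row22 a b k12_eq)
  have s: "s = - 1" and k12: "k12 = a * b" and \<theta>0: "\<theta>0 = k11 + b\<^sup>2"
    and k22: "k22 = k11 - a\<^sup>2 + b\<^sup>2"
    using two_valency_parameters[OF a(1) b(1) ab _ a2 b2 eig compl q11 q22 q21] n by auto

  \<comment> \<open>The second eigenvalue of the quotient matrix\<close>
  define t where "t = k11 - a\<^sup>2"
  \<comment> \<open>The vector is constant on each class and orthogonal to \<alpha>. On
    \<open>V1\<close> the equation holds because k12 = a b gives k11 b - k12 a = (k11 - a^2)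
    b.\<close>
  have "eigenvalue A t"
    unfolding real_eigenvalue_iff[OF A]
  proof (intro exI[of _ "\<lambda>i. if i < n then b else - a"] conjI allI impI)
    show "\<exists>i<n + n. (if i < n then b else - a) \<noteq> 0" using n b by (intro exI[of _ 0]) auto
    fix i assume i: "i < n + n"
    show "(\<Sum>j<n + n. A $$ (i, j) * (if j < n then b else - a)) = t * (if i < n then b else - a)"
    proof (cases "i < n")
      case True
      have "(\<Sum>j<n + n. A $$ (i, j) * (if j < n then b else - a)) = k11 * b - k12 * a"
        unfolding row11[OF True, symmetric] row12[OF True, symmetric]
        using True by (simp add: sum_lessThan_add A1idx BTidx[OF True] sum_distrib_right sum_negf)
      also have "\<dots> = t * b" unfolding t_def k12 by (simp add: power2_eq_square algebra_simps)
      finally show ?thesis using True by simp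
    next
      case False
      then obtain i' where i': "i = n + i'" "i' < n"
        using i by (metis add_less_cancel_left le_Suc_ex not_less)
      have "(\<Sum>j<n + n. A $$ (i, j) * (if j < n then b else - a)) = k12 * b - k22 * a"
        unfolding k12_eq row21[OF i'(2), symmetric] row22[OF i'(2), symmetric]
        using i' by (simp add: sum_lessThan_add Bidx A2idx sum_distrib_right sum_negf)
      also have "\<dots> = t * (- a)" unfolding t_def k12 k22 by (simp add: power2_eq_square algebra_simps)
      finally show ?thesis using False by simp
    qed
  qed
  then have "t \<in> {\<theta>0, \<theta>1, \<theta>2}" using spec by (auto simp: spectrum_def)
  \<comment> \<open>The difference of \<open>\<theta>0\<close> and \<open>t\<close> is a^2 + b^2. So
    \<open>t\<close> is one of the two smaller eigenvalues, and their sum -1 determines the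
    other.\<close>
  moreover have "t < \<theta>0" using zero_less_power[OF a(1), of 2] zero_less_power[OF b(1), of 2] unfolding t_def \<theta>0 by linarith
  ultimately have t: "t = \<theta>1 \<and> \<theta>2 = - 1 - t \<or> t = \<theta>2 \<and> \<theta>1 = - 1 - t"
    using s by (auto simp: s_def)
  have "p = t * (- 1 - t)"
    unfolding p_def using t by (elim disjE conjE) (simp_all only: mult.commute)
  then have p: "p = - t * (t + 1)" by (simp add: algebra_simps)
  have \<theta>0t: "\<theta>0 = real n - 1 - t" using compl k22 by (simp add: \<theta>0 t_def)

  \<comment> \<open>Spectrum of the quotient matrix and multiplicities in \<open>A\<close>\<close>
  have "spectrum Q = {\<theta>0, t}"
  proof -
    have char: "(k11 - e) * (k22 - e) = k12 * k21 \<longleftrightarrow> (e - \<theta>0) * (e - t) = 0" for e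
    proof -
      have "(k11 - e) * (k22 - e) - k12 * k21 = (e - \<theta>0) * (e - t)"
        unfolding k12_eq[symmetric] k12 k22 \<theta>0 t_def by (simp add: power2_eq_square algebra_simps)
      then show ?thesis by auto
    qed
    show ?thesis unfolding spectrum_def assms(21) eigenvalue_mat2_iff char by auto
  qed
  moreover have "eigenvalue_mset A
    = {#\<theta>0#} + replicate_mset n t + replicate_mset (n - 1) (- t - 1)"
  proof -
    have tr: "0 = \<theta>0 + real m * \<theta>1 + real l * \<theta>2" using trace by (simp add: diag)
    have m: "real m = 2 * real n - 1 - real l" and l: "real l = 2 * real n - 1 - real m"
      using ml by linarith+
    \<comment> \<open>Up to sign this is the difference of \<open>\<theta>1\<close> and
      \<open>\<theta>2\<close>. After elimination of one multiplicity, the zero trace says that it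
      times (multiplicity of \<open>t\<close> minus n) is 0.\<close>
    have ne: "2 * t + 1 \<noteq> 0" using t \<theta> by auto
    from t show ?thesis
    proof
      assume "t = \<theta>1 \<and> \<theta>2 = - 1 - t"
      then have th: "\<theta>1 = t" "\<theta>2 = - t - 1" by auto
      have "(real m - real n) * (2 * t + 1) = 0"
        using tr unfolding \<theta>0t th l by (simp add: algebra_simps)
      with ne have "m = n" by simp
      moreover from this ml have "l = n - 1" by simp
      ultimately show ?thesis unfolding eigenvalue_mset_def roots th by simp
    next
      assume "t = \<theta>2 \<and> \<theta>1 = - 1 - t"
      then have th: "\<theta>2 = t" "\<theta>1 = - t - 1" by auto
      have "(real l - real n) * (2 * t + 1) = 0"
        using tr unfolding \<theta>0t th m by (simp add: algebra_simps)
      with ne have "l = n" by simp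
      moreover from this ml have "m = n - 1" by simp
      ultimately show ?thesis unfolding eigenvalue_mset_def roots th by simp
    qed
  qed

  \<comment> \<open>The matrix identities\<close>
  moreover have "transpose_mat B * B = (t \<cdot>\<^sub>m I - A1) * (t \<cdot>\<^sub>m I - (J - I - A1))"
  proof (rule eq_matI)
    fix i j assume "i < dim_row ((t \<cdot>\<^sub>m I - A1) * (t \<cdot>\<^sub>m I - (J - I - A1)))"
      and "j < dim_col ((t \<cdot>\<^sub>m I - A1) * (t \<cdot>\<^sub>m I - (J - I - A1)))"
    then have ij: "i < n" "j < n" using A1 by auto
    have "(transpose_mat B * B) $$ (i, j) = (\<Sum>k<n. B $$ (k, i) * B $$ (k, j))"
      using ij B by (subst mult_mat_index[of _ n n _ n]) auto
    \<comment> \<open>Both sides equal a^2 J + t(t+1)I - A1 - A1^2: on the right the coefficient of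
      J is k11 - t = a^2.\<close>
    also have "\<dots> = ((t \<cdot>\<^sub>m I - A1) * (t \<cdot>\<^sub>m I - (J - I - A1))) $$ (i, j)"
      unfolding I J complement_product_index[OF A1 ij] row11[OF ij(1)]
      using rank11[OF ij] by (simp add: s p t_def algebra_simps)
    finally show "(transpose_mat B * B) $$ (i, j)
      = ((t \<cdot>\<^sub>m I - A1) * (t \<cdot>\<^sub>m I - (J - I - A1))) $$ (i, j)" .
  qed (use A1 B in auto)
  moreover have "B * transpose_mat B = (t \<cdot>\<^sub>m I - A2) * (t \<cdot>\<^sub>m I - (J - I - A2))"
  proof (rule eq_matI)
    fix i j assume "i < dim_row ((t \<cdot>\<^sub>m I - A2) * (t \<cdot>\<^sub>m I - (J - I - A2)))"
      and "j < dim_col ((t \<cdot>\<^sub>m I - A2) * (t \<cdot>\<^sub>m I - (J - I - A2)))"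
    then have ij: "i < n" "j < n" using A2 by auto
    have "(B * transpose_mat B) $$ (i, j) = (\<Sum>k<n. B $$ (i, k) * B $$ (j, k))"
      using ij B by (subst mult_mat_index[of _ n n _ n]) auto
    \<comment> \<open>Here the coefficient of J is k22 - t = b^2.\<close>
    also have "\<dots> = ((t \<cdot>\<^sub>m I - A2) * (t \<cdot>\<^sub>m I - (J - I - A2))) $$ (i, j)"
      unfolding I J complement_product_index[OF A2 ij] row22[OF ij(1)]
      using rank22[OF ij] k22 by (simp add: s p t_def algebra_simps)
    finally show "(B * transpose_mat B) $$ (i, j)
      = ((t \<cdot>\<^sub>m I - A2) * (t \<cdot>\<^sub>m I - (J - I - A2))) $$ (i, j)" .
  qed (use A2 B in auto)
  \<comment> \<open>The lower left block reads B A1 + A2 B + B = a b J, and a b J = k12 J = J B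
    because the columns of \<open>B\<close> sum to \<open>k12\<close>.\<close>
  moreover have "B * A1 = ?C * B"
  proof (rule eq_matI)
    fix i j assume "i < dim_row (?C * B)" and "j < dim_col (?C * B)"
    then have ij: "i < n" "j < n" using A2 B by auto
    have "(?C * B) $$ (i, j) = (\<Sum>k<n. ?C $$ (i, k) * B $$ (k, j))"
      by (rule mult_mat_index[OF C B ij])
    also have "\<dots> = (\<Sum>k<n. B $$ (k, j) - (if k = i then B $$ (i, j) else 0) - A2 $$ (i, k) * B $$ (k, j))"
      using ij by (intro sum.cong) (auto simp: Cidx algebra_simps)
    also have "\<dots> = k12 - B $$ (i, j) - (\<Sum>k<n. A2 $$ (i, k) * B $$ (k, j))"
      using ij by (simp add: sum_subtractf row12)
    also have "\<dots> = (\<Sum>k<n. B $$ (i, k) * A1 $$ (k, j))"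
      using rank21[OF ij] by (simp add: s k12 algebra_simps)
    also have "\<dots> = (B * A1) $$ (i, j)"
      by (rule mult_mat_index[OF B A1 ij, symmetric])
    finally show "(B * A1) $$ (i, j) = (?C * B) $$ (i, j)" by simp
  qed (use A1 A2 B in auto)
  moreover have "t \<in> {\<theta>1, \<theta>2}" using t by auto
  ultimately show ?thesis using k12_eq by blast
qed

end
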